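(* Let $m$ be an odd integer with $5 \le m \le 49$. Then the complete symmetric digraph $K_{2m}^\ast$ admits a resolvable decomposition into directed $m$-cycles.
   Context: $K_n^\ast$ denotes the complete symmetric digraph of order $n$: it has $n$ vertices and, for each pair of distinct vertices $u,v$, both arcs $(u,v)$ and $(v,u)$ (no loops, no multiple arcs). A decomposition of a digraph $D$ is a collection of subdigraphs whose arc sets partition the arc set of $D$. A resolution class of a decomposition is a subcollection whose members' vertex sets partition the vertex set of $D$; a decomposition is resolvable if it can be partitioned into resolution classes. A directed $m$-cycle is a directed cycle of length $m$. *)

theory Defs
  imports "Graph_Theory.Graph_Theory" "HOL-Library.Disjoint_Sets"
begin

(* K_n^* is the library's complete_digraph n: a finite digraph without loops or multiple arcs
   on n vertices whose arcs join exactly the ordered pairs of distinct vertices. *)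

lemma complete_digraph_exists: "\<exists>G :: (nat, nat \<times> nat) pre_digraph. complete_digraph n G"
proof -
  let ?G = "\<lparr>pverts = {..<n}, parcs = {(u, v). (u, v) \<in> {..<n} \<times> {..<n} \<and> u \<noteq> v}\<rparr>"
  have "complete_digraph n (with_proj ?G)"
    by (subst complete_digraph_pair_def) simp
  then show ?thesis by blast
qed

(* The library's cycle is an arc list; here the whole digraph C is a directed cycle of
   length m, i.e. such an arc list uses all arcs and all vertices of C. *)
definition directed_cycle :: "nat \<Rightarrow> ('a, 'b) pre_digraph \<Rightarrow> bool" where
  "directed_cycle m C \<longleftrightarrow> wf_digraph C \<and>
     (\<exists>p. pre_digraph.cycle C p \<and> length p = m \<and> arcs C = set p \<and> verts C = tail C ` set p)"

(* partition_on speaks about a set of sets; inj_on excludes distinct members sharing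
   the same arc set (below: the same vertex set). *)
definition decomposition :: "('a, 'b) pre_digraph \<Rightarrow> ('a, 'b) pre_digraph set \<Rightarrow> bool" where
  "decomposition G \<D> \<longleftrightarrow>
     (\<forall>H \<in> \<D>. subgraph H G) \<and> inj_on arcs \<D> \<and> partition_on (arcs G) (arcs ` \<D>)"

definition resolution_class ::
  "('a, 'b) pre_digraph \<Rightarrow> ('a, 'b) pre_digraph set \<Rightarrow> ('a, 'b) pre_digraph set \<Rightarrow> bool" where
  "resolution_class G \<D> \<R> \<longleftrightarrow>
     \<R> \<subseteq> \<D> \<and> inj_on verts \<R> \<and> partition_on (verts G) (verts ` \<R>)"

definition resolvable :: "('a, 'b) pre_digraph \<Rightarrow> ('a, 'b) pre_digraph set \<Rightarrow> bool" where
  "resolvable G \<D> \<longleftrightarrow> (\<exists>\<P>. partition_on \<D> \<P> \<and> (\<forall>\<R> \<in> \<P>. resolution_class G \<D> \<R>))"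

end

theory Submission
  imports Defs "HOL-Library.Code_Binary_Nat"
begin

text \<open>Write \<open>n = 2m - 2\<close> and take \<open>\<int>\<^sub>n\<close> together with two points at infinity as vertices. Cutting the
  zigzag sequencing of \<open>\<int>\<^sub>n\<close> in the middle gives two paths with \<open>m - 1\<close> vertices each, and closing
  each of them through its own point at infinity gives a starter class. Its \<open>n\<close> translates use
  every arc exactly once, except for the arcs of difference \<open>n / 2\<close> and the two arcs between the
  points at infinity. These leftover arcs form a 2-factor of the wrong cycle type; but together
  with the first few translates they can be rearranged into classes of two \<open>m\<close>-cycles each. Such
  rearrangements were found by a computer search that exchanges alternating cycles between
  factors, and are listed explicitly for every \<open>m\<close>.\<close>

section \<open>Resolvable decompositions from coverings\<close>

text \<open>Translating an arc preserves its difference if both ends are finite, and its point at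
  infinity otherwise. A starter therefore needs one arc for each nonzero difference, and one arc
  into and one arc out of each point at infinity. Since both cycles must have the same length, the
  zigzag has to be cut in the middle, and the cut loses one of its \<open>n - 1\<close> steps. The
  lost difference \<open>n / 2\<close> is its own negative, so the lost arcs join \<open>x\<close>
  and \<open>x + n / 2\<close> in both directions; with the two arcs between the points at infinity
  they make up \<open>m\<close> directed 2-cycles. This factor has \<open>2 * m\<close> arcs,
  exactly as many as one class. Exchanging arcs between it and \<open>k\<close> translates can thus
  yield \<open>k + 1\<close> classes, and the total becomes \<open>n + 1 = 2 * m - 1\<close>.
  Because the numbers of arcs agree, a certificate is tested for inclusion only: disjointness
  follows by counting.\<close>

text \<open>Removing the first arc shifts both the arc and the vertex sequence by one, so the
  induction has to generalise over both functions.\<close>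

lemma cas_map_consecutive:
  assumes "\<And>k. k < l \<Longrightarrow> tail H (a k) = w k \<and> head H (a k) = w (Suc k)"
  shows "pre_digraph.cas H (w 0) (map a [0..<l]) (w l)"
  using assms
proof (induction l arbitrary: a w)
  case 0
  show ?case by (simp add: pre_digraph.cas.simps)
next
  case (Suc l)
  have "pre_digraph.cas H (w (Suc 0)) (map (\<lambda>k. a (Suc k)) [0..<l]) (w (Suc l))"
    using Suc.IH[of "\<lambda>k. a (Suc k)" "\<lambda>k. w (Suc k)"] Suc.prems by simp
  moreover have "map a [0..<Suc l] = a 0 # map (\<lambda>k. a (Suc k)) [0..<l]"
    by (subst map_upt_Suc) simp
  ultimately show ?case
    using Suc.prems[of 0] by (simp add: pre_digraph.cas.simps del: upt_Suc)
qed

text \<open>Bridge from cycles indexed by positions modulo \<open>m\<close> to the arc lists of the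
  library; everything after it works with positions only.\<close>

lemma directed_cycleI:
  assumes "m > 0"
    and inj: "inj_on w {..<m}"
    and verts: "verts H = w ` {..<m}"
    and arcs: "arcs H = a ` {..<m}"
    and ends: "\<And>k. k < m \<Longrightarrow> tail H (a k) = w k \<and> head H (a k) = w (Suc k mod m)"
  shows "directed_cycle m H"
proof -
  let ?p = "map a [0..<m]" and ?w = "\<lambda>k. w (k mod m)"
  have wf: "wf_digraph H"
    using \<open>m > 0\<close> ends by unfold_locales (auto simp: verts arcs)
  have tails: "map (tail H) ?p = map w [0..<m]"
    using ends by simp
  have "?p \<noteq> []"
    using \<open>m > 0\<close> by simp
  \<comment> \<open>Reading positions modulo \<open>m\<close> makes a walk of \<open>m\<close> arcs
    end at \<open>w (m mod m) = w 0\<close>.\<close>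
  moreover have cas: "pre_digraph.cas H (w 0) ?p (w 0)"
    using cas_map_consecutive[of m H a ?w] ends \<open>m > 0\<close> by simp
  then have "pre_digraph.awalk H (w 0) ?p (w 0)"
    using \<open>m > 0\<close> by (auto simp: pre_digraph.awalk_def verts arcs)
  \<comment> \<open>The vertex list of the closed walk has \<open>w 0\<close> at both ends; dropping
    the first entry leaves each of the \<open>m\<close> vertices once.\<close>
  moreover have "distinct (tl (pre_digraph.awalk_verts H (w 0) ?p))"
  proof -
    have "head H (last ?p) = w 0"
      using ends[of "m - 1"] \<open>m > 0\<close> by (simp add: last_map)
    then have "pre_digraph.awalk_verts H (w 0) ?p = map w [0..<m] @ [w 0]"
      using tails \<open>m > 0\<close> by (simp add: pre_digraph.awalk_verts_conv)
    moreover have "[0..<m] = 0 # [Suc 0..<m]"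
      using \<open>m > 0\<close> by (simp add: upt_conv_Cons)
    ultimately have "tl (pre_digraph.awalk_verts H (w 0) ?p) = map w [Suc 0..<m] @ [w 0]"
      by simp
    moreover have "distinct (map w [0..<m])"
      using inj by (simp add: distinct_map atLeast0LessThan)
    ultimately show ?thesis
      using \<open>[0..<m] = 0 # [Suc 0..<m]\<close> by auto
  qed
  ultimately have "pre_digraph.cycle H ?p"
    unfolding pre_digraph.cycle_def by blast
  moreover have "set ?p = a ` {..<m}"
    by (simp add: atLeast0LessThan)
  moreover have "tail H ` set ?p = w ` {..<m}"
    using ends by (force simp: image_image atLeast0LessThan intro!: image_cong)
  ultimately show ?thesis
    unfolding directed_cycle_def using wf verts arcs by (intro conjI exI[of _ ?p]) auto
qed

text \<open>The arc type is arbitrary, but without parallel arcs \<open>arc_to_ends\<close> is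
  injective, so the arcs can be counted as the ordered pairs off the diagonal.\<close>

lemma card_arcs_complete_digraph:
  assumes "complete_digraph n G"
  shows "card (arcs G) = n * (n - 1)"
proof -
  interpret graph G
    using assms by (simp add: complete_digraph_def)
  let ?V = "verts G"
  have n: "card ?V = n"
    using assms by (simp add: complete_digraph_def)
  have "arcs_ends G = ?V \<times> ?V - (\<lambda>v. (v, v)) ` ?V"
    using assms by (auto simp: complete_digraph_def)
  moreover have "card (?V \<times> ?V - (\<lambda>v. (v, v)) ` ?V) = n * n - n"
    by (subst card_Diff_subset) (auto simp: card_cartesian_product n card_image inj_on_def)
  moreover have "card (arcs_ends G) = card (arcs G)"
    unfolding arcs_ends_def by (rule card_image[OF inj_on_arc_to_ends])
  ultimately show ?thesis
    by (simp add: diff_mult_distrib2)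
qed

text \<open>It suffices to cover every ordered pair: the \<open>2m - 1\<close> classes have just enough arcs, so by
  counting no arc is covered twice.\<close>

lemma resolvable_decompositionI:
  fixes G :: "('a, 'b) pre_digraph" and c :: "nat \<Rightarrow> bool \<Rightarrow> nat \<Rightarrow> 'a"
  assumes "m \<ge> 2" and G: "complete_digraph (2 * m) G"
    and bij: "\<And>i. i < 2 * m - 1 \<Longrightarrow> bij_betw (\<lambda>(b, k). c i b k) (UNIV \<times> {..<m}) (verts G)"
    and cover: "\<And>u v. u \<in> verts G \<Longrightarrow> v \<in> verts G \<Longrightarrow> u \<noteq> v \<Longrightarrow>
      \<exists>i<2 * m - 1. \<exists>b. \<exists>k<m. u = c i b k \<and> v = c i b (Suc k mod m)"
  shows "\<exists>\<D>. decomposition G \<D> \<and> resolvable G \<D> \<and> (\<forall>C \<in> \<D>. directed_cycle m C)"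
proof -
  interpret graph G
    using G by (simp add: complete_digraph_def)
  have ends_G: "arcs_ends G = {(u, v). (u, v) \<in> verts G \<times> verts G \<and> u \<noteq> v}"
    using G by (simp add: complete_digraph_def)
  define J where "J = {..<2 * m - 1}"
  \<comment> \<open>The cycles are given by their vertices, whereas members of a decomposition need
    arcs of \<open>G\<close>: \<open>a i b k\<close> is the arc of \<open>G\<close> with the
    prescribed ends.\<close>
  define a where "a i b k = inv_into (arcs G) (arc_to_ends G) (c i b k, c i b (Suc k mod m))" for i b k
  define D where "D i b = G\<lparr>verts := c i b ` {..<m}, arcs := a i b ` {..<m}\<rparr>" for i b
  define g where "g = (\<lambda>(i, b, k). a i b k)"
  define I where "I = J \<times> (UNIV :: bool set) \<times> {..<m}"
  have c_in: "c i b k \<in> verts G" if "i \<in> J" "k < m" for i b k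
    using bij_betwE[OF bij[of i]] that by (force simp: J_def)
  have c_inj: "b = b' \<and> k = k'" if "i \<in> J" "k < m" "k' < m" "c i b k = c i b' k'" for i b b' k k'
    using inj_onD[OF bij_betw_imp_inj_on[OF bij[of i]], of "(b, k)" "(b', k')"] that
    by (simp add: J_def)
  have c_surj: "\<exists>b. \<exists>k<m. v = c i b k" if "i \<in> J" "v \<in> verts G" for i v
  proof -
    have "v \<in> (\<lambda>(b, k). c i b k) ` (UNIV \<times> {..<m})"
      using bij_betw_imp_surj_on[OF bij[of i]] that by (simp add: J_def)
    then show ?thesis by auto
  qed
  have a: "a i b k \<in> arcs G \<and> tail G (a i b k) = c i b k \<and> head G (a i b k) = c i b (Suc k mod m)"
    if "i \<in> J" "k < m" for i b k
  proof -
    \<comment> \<open>A loop is never requested: for \<open>m \<ge> 2\<close> the cyclic successor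
      is another position, also at the wrap-around.\<close>
    have "Suc k mod m \<noteq> k"
    proof (cases "Suc k = m")
      case True
      then show ?thesis using \<open>m \<ge> 2\<close> by auto
    next
      case False
      then show ?thesis using \<open>k < m\<close> by simp
    qed
    moreover have "Suc k mod m < m"
      using \<open>m \<ge> 2\<close> by simp
    ultimately have "(c i b k, c i b (Suc k mod m)) \<in> arc_to_ends G ` arcs G"
      using c_in that c_inj[of i k "Suc k mod m" b b] ends_G by (auto simp: arcs_ends_def)
    then show ?thesis
      using inv_into_into f_inv_into_f unfolding a_def
      by (metis (no_types, lifting) arc_to_ends_def prod.inject)
  qed
  have "arcs G \<subseteq> g ` I"
  proof
    fix e assume e: "e \<in> arcs G"
    then obtain i b k where i: "i < 2 * m - 1" and k: "k < m"
      and "tail G e = c i b k" "head G e = c i b (Suc k mod m)"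
      using cover[of "tail G e" "head G e"] no_loops by force
    then have "arc_to_ends G e = arc_to_ends G (a i b k)"
      using a[of i k b] by (simp add: arc_to_ends_def J_def)
    \<comment> \<open>The covering hypothesis speaks of ends only; in the absence of parallel arcs,
      equal ends mean equal arcs.\<close>
    then have "e = a i b k"
      using no_multi_arcs e a[of i k b] i k by (simp add: J_def)
    then show "e \<in> g ` I"
      using i k by (auto simp: g_def I_def J_def intro!: rev_image_eqI[of "(i, b, k)"])
  qed
  then have g_img: "g ` I = arcs G"
    using a by (auto simp: g_def I_def)
  have "card I = 2 * m * (2 * m - 1)"
    by (simp add: I_def J_def card_cartesian_product)
  \<comment> \<open>The counting step: \<open>g\<close> maps \<open>I\<close> onto a set of the same
    finite size, so it is injective and no arc is used by two positions.\<close>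
  then have "inj_on g I"
    using card_arcs_complete_digraph[OF G] g_img
    by (intro eq_card_imp_inj_on) (auto simp: I_def J_def)
  then have a_inj: "i = i' \<and> b = b' \<and> k = k'"
    if "i \<in> J" "i' \<in> J" "k < m" "k' < m" "a i b k = a i' b' k'" for i i' b b' k k'
    using inj_onD[of g I "(i, b, k)" "(i', b', k')"] that by (simp add: g_def I_def)
  have D_simps: "verts (D i b) = c i b ` {..<m}" "arcs (D i b) = a i b ` {..<m}"
    "tail (D i b) = tail G" "head (D i b) = head G" for i b
    by (simp_all add: D_def)
  have arcs_disj: "i = i' \<and> b = b'"
    if "i \<in> J" "i' \<in> J" "e \<in> arcs (D i b)" "e \<in> arcs (D i' b')" for i i' b b' e
    using that unfolding D_simps by (elim imageE) (use a_inj that(1,2) in blast)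
  have arcs_ne: "arcs (D i b) \<noteq> {}" and verts_ne: "verts (D i b) \<noteq> {}" for i b
    using \<open>m \<ge> 2\<close> by (auto simp: D_simps lessThan_empty_iff)
  have verts_disj: "b = b'" if "i \<in> J" "v \<in> verts (D i b)" "v \<in> verts (D i b')" for i b b' v
    using that unfolding D_simps by (elim imageE) (use c_inj that(1) in blast)
  define \<D> where "\<D> = (\<lambda>(i, b). D i b) ` (J \<times> UNIV)"
  have cyc: "directed_cycle m (D i b)" if "i \<in> J" for i b
    by (rule directed_cycleI[where w = "c i b" and a = "a i b"])
      (use \<open>m \<ge> 2\<close> that a c_inj in \<open>auto simp: D_simps inj_on_def\<close>)
  have sub: "subgraph (D i b) G" if "i \<in> J" for i b
  proof -
    have "wf_digraph (D i b)"
      using cyc[OF that] by (simp add: directed_cycle_def)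
    then show ?thesis
      using that a c_in wf_digraph by (auto simp: subgraph_def D_simps compatible_def)
  qed
  have "decomposition G \<D>"
    unfolding decomposition_def
  proof (intro conjI)
    show "\<forall>H\<in>\<D>. subgraph H G"
      using sub by (auto simp: \<D>_def)
    show "inj_on arcs \<D>"
    proof (rule inj_onI)
      fix H H' assume "H \<in> \<D>" "H' \<in> \<D>" and eq: "arcs H = arcs H'"
      then obtain i b i' b' where "i \<in> J" "i' \<in> J" "H = D i b" "H' = D i' b'"
        by (auto simp: \<D>_def)
      with eq arcs_ne[of i b] arcs_disj[of i i' _ b b'] show "H = H'"
        by blast
    qed
    show "partition_on (arcs G) (arcs ` \<D>)"
    proof (rule partition_onI)
      show "\<Union>(arcs ` \<D>) = arcs G"
        unfolding g_img[symmetric] by (force simp: \<D>_def g_def I_def D_simps)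
      show "disjnt p q" if pq: "p \<in> arcs ` \<D>" "q \<in> arcs ` \<D>" "p \<noteq> q" for p q
      proof -
        obtain i b i' b' where "i \<in> J" "i' \<in> J" "p = arcs (D i b)" "q = arcs (D i' b')"
          using pq(1,2) by (auto simp: \<D>_def)
        with \<open>p \<noteq> q\<close> arcs_disj[of i i' _ b b'] show ?thesis
          unfolding disjnt_iff by blast
      qed
      show "{} \<notin> arcs ` \<D>"
        using arcs_ne by (auto simp: \<D>_def)
    qed
  qed
  moreover have "resolvable G \<D>"
  proof -
    define R where "R i = {D i b | b. True}" for i
    have "partition_on \<D> (R ` J)"
    proof (rule partition_onI)
      show "\<Union>(R ` J) = \<D>"
        by (fastforce simp: R_def \<D>_def)
      show "disjnt p q" if pq: "p \<in> R ` J" "q \<in> R ` J" "p \<noteq> q" for p q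
      proof -
        obtain i i' where i: "i \<in> J" "i' \<in> J" "p = R i" "q = R i'"
          using pq(1,2) by blast
        \<comment> \<open>A common member would have a nonempty arc set shared by the indices
          \<open>i\<close> and \<open>i'\<close>, forcing \<open>i = i'\<close>.\<close>
        have "D i b \<noteq> D i' b'" for b b'
          using i \<open>p \<noteq> q\<close> arcs_ne[of i b] arcs_disj[of i i' _ b b'] by auto
        then show ?thesis
          unfolding i R_def disjnt_iff by blast
      qed
      show "{} \<notin> R ` J"
        by (auto simp: R_def)
    qed
    moreover have "resolution_class G \<D> (R i)" if "i \<in> J" for i
      unfolding resolution_class_def
    proof (intro conjI)
      show "R i \<subseteq> \<D>"
        using that by (auto simp: R_def \<D>_def)
      show "inj_on verts (R i)"
      proof (rule inj_onI)
        fix H H' assume "H \<in> R i" "H' \<in> R i" and eq: "verts H = verts H'"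
        then obtain b b' where "H = D i b" "H' = D i b'"
          by (auto simp: R_def)
        with eq verts_ne[of i b] verts_disj[OF that, of _ b b'] show "H = H'"
          by blast
      qed
      show "partition_on (verts G) (verts ` R i)"
      proof (rule partition_onI)
        show "\<Union>(verts ` R i) = verts G"
          using c_in[OF that] c_surj[OF that] by (fastforce simp: R_def D_simps)
        show "disjnt p q" if pq: "p \<in> verts ` R i" "q \<in> verts ` R i" "p \<noteq> q" for p q
        proof -
          obtain b b' where "p = verts (D i b)" "q = verts (D i b')"
            using pq(1,2) by (auto simp: R_def)
          with \<open>p \<noteq> q\<close> verts_disj[OF \<open>i \<in> J\<close>, of _ b b'] show ?thesis
            unfolding disjnt_iff by blast
        qed
        show "{} \<notin> verts ` R i"
          using verts_ne[of i] by (auto simp: R_def)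
      qed
    qed
    ultimately show ?thesis
      unfolding resolvable_def by blast
  qed
  moreover have "\<forall>C\<in>\<D>. directed_cycle m C"
    using cyc by (auto simp: \<D>_def)
  ultimately show ?thesis by blast
qed

section \<open>Executable inclusion of lists\<close>

text \<open>Inclusion between long lists of numbers is decided by rewriting with first-order equations
  that branch on constructors only: the simplifier is much slower on sorting or on pairwise
  comparison.\<close>

datatype num_trie = Tip | Bin bool num_trie num_trie

fun insert_num :: "num \<Rightarrow> num_trie \<Rightarrow> num_trie" where
  "insert_num num.One Tip = Bin True Tip Tip"
| "insert_num num.One (Bin b l r) = Bin True l r"
| "insert_num (num.Bit0 k) Tip = Bin False (insert_num k Tip) Tip"
| "insert_num (num.Bit0 k) (Bin b l r) = Bin b (insert_num k l) r"
| "insert_num (num.Bit1 k) Tip = Bin False Tip (insert_num k Tip)"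
| "insert_num (num.Bit1 k) (Bin b l r) = Bin b l (insert_num k r)"

fun member_num :: "num_trie \<Rightarrow> num \<Rightarrow> bool" where
  "member_num Tip k \<longleftrightarrow> False"
| "member_num (Bin b l r) num.One \<longleftrightarrow> b"
| "member_num (Bin b l r) (num.Bit0 k) \<longleftrightarrow> member_num l k"
| "member_num (Bin b l r) (num.Bit1 k) \<longleftrightarrow> member_num r k"

lemma member_insert_num: "member_num (insert_num k t) j \<longleftrightarrow> j = k \<or> member_num t j"
proof (induction k t arbitrary: j rule: insert_num.induct)
qed (case_tac j; simp)+

text \<open>Entries are shifted by \<open>Suc\<close> because \<open>num\<close> starts at one:
  \<open>num_of_nat\<close> sends both 0 and 1 to \<open>num.One\<close> and would confuse these two
  vertices.\<close>

primrec trie_of_list :: "nat list \<Rightarrow> num_trie" where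
  "trie_of_list [] = Tip"
| "trie_of_list (x # xs) = insert_num (num_of_nat (Suc x)) (trie_of_list xs)"

primrec all_members :: "num_trie \<Rightarrow> nat list \<Rightarrow> bool" where
  "all_members t [] \<longleftrightarrow> True"
| "all_members t (y # ys) \<longleftrightarrow> member_num t (num_of_nat (Suc y)) \<and> all_members t ys"

text \<open>A separate constant, so that evaluation can use the trie equation below while proofs
  unfold it to an inclusion of sets.\<close>

definition covers :: "nat list \<Rightarrow> nat list \<Rightarrow> bool" where
  "covers xs ys \<longleftrightarrow> set ys \<subseteq> set xs"

lemma num_of_nat_Suc_inject: "num_of_nat (Suc x) = num_of_nat (Suc y) \<longleftrightarrow> x = y"
  by (metis Suc_inject num_of_nat_inverse zero_less_Suc)

lemma member_trie_of_list: "member_num (trie_of_list xs) (num_of_nat (Suc y)) \<longleftrightarrow> y \<in> set xs"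
  by (induction xs) (simp_all add: member_insert_num num_of_nat_Suc_inject del: num_of_nat.simps)

text \<open>The covering list is stored once; each entry of the other list then costs a single
  descent along its binary digits.\<close>

lemma covers_code [code]: "covers xs ys \<longleftrightarrow> all_members (trie_of_list xs) ys"
  unfolding covers_def
  by (induction ys) (simp_all add: member_trie_of_list del: num_of_nat.simps)

section \<open>Pairs of cycles on numbers\<close>

type_synonym 'a cycle_pair = "'a list \<times> 'a list"

text \<open>A cycle is stored as its list of vertices. Pairing with \<open>rotate1\<close> includes
  the closing arc and needs no index arithmetic when evaluated.\<close>

definition cycle_arcs :: "'a list \<Rightarrow> ('a \<times> 'a) list" where
  "cycle_arcs xs = zip xs (rotate1 xs)"

definition pair_arcs :: "'a cycle_pair \<Rightarrow> ('a \<times> 'a) list" where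
  "pair_arcs c = cycle_arcs (fst c) @ cycle_arcs (snd c)"

definition is_pair :: "nat \<Rightarrow> nat cycle_pair \<Rightarrow> bool" where
  "is_pair m c \<longleftrightarrow>
     length (fst c) = m \<and> length (snd c) = m \<and> covers (fst c @ snd c) [0..<2 * m]"

text \<open>Pigeonhole: \<open>2 * m\<close> entries that hit all \<open>2 * m\<close> vertices
  leave room neither for a repetition nor for a foreign entry. This is why \<open>is_pair\<close>
  tests only lengths and covering.\<close>

lemma is_pairD:
  assumes "is_pair m c"
  shows "length (fst c) = m" "length (snd c) = m" "distinct (fst c @ snd c)"
    "set (fst c @ snd c) = {..<2 * m}"
proof -
  let ?xs = "fst c @ snd c"
  have len: "length ?xs = 2 * m" and sub: "{..<2 * m} \<subseteq> set ?xs"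
    using assms by (auto simp: is_pair_def covers_def atLeast0LessThan)
  have "card (set ?xs) \<le> card {..<2 * m}"
    using card_length[of ?xs] len by simp
  then show eq: "set ?xs = {..<2 * m}"
    using card_seteq[OF finite_set sub] by simp
  show "distinct ?xs"
    by (rule card_distinct) (simp only: eq len card_lessThan)
qed (use assms in \<open>simp_all add: is_pair_def\<close>)

lemma is_pairI:
  assumes "length (fst c) = m" "length (snd c) = m" "set (fst c @ snd c) = {..<2 * m}"
  shows "is_pair m c"
  unfolding is_pair_def covers_def using assms by (simp add: atLeast0LessThan)

lemma set_cycle_arcs:
  "set (cycle_arcs xs) = {(xs ! k, xs ! (Suc k mod length xs)) |k. k < length xs}"
  unfolding cycle_arcs_def set_zip by (auto simp: nth_rotate1)

lemma cycle_arcs_map: "cycle_arcs (map f xs) = map (map_prod f f) (cycle_arcs xs)"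
  by (simp add: cycle_arcs_def rotate1_map zip_map_map map_prod_def split_def)

lemma pair_arcs_map:
  "pair_arcs (map_prod (map f) (map f) c) = map (map_prod f f) (pair_arcs c)"
  by (simp add: pair_arcs_def cycle_arcs_map)

text \<open>Any enumeration of the vertices of \<open>G\<close> transports the problem to the
  numbers below \<open>2 * m\<close>, since a complete digraph looks the same under every labelling.
  The boolean index selects one of the two cycles of a class.\<close>

lemma resolvable_decomposition_of_pairs:
  fixes G :: "('a, 'b) pre_digraph"
  assumes "m \<ge> 2" and G: "complete_digraph (2 * m) G"
    and len: "length Fs = 2 * m - 1"
    and pairs: "\<And>c. c \<in> set Fs \<Longrightarrow> is_pair m c"
    and cover: "\<And>u v. u < 2 * m \<Longrightarrow> v < 2 * m \<Longrightarrow> u \<noteq> v \<Longrightarrow> \<exists>c\<in>set Fs. (u, v) \<in> set (pair_arcs c)"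
  shows "\<exists>\<D>. decomposition G \<D> \<and> resolvable G \<D> \<and> (\<forall>C \<in> \<D>. directed_cycle m C)"
proof -
  interpret graph G
    using G by (simp add: complete_digraph_def)
  have "card (verts G) = 2 * m"
    using G by (simp add: complete_digraph_def)
  then obtain f where f: "bij_betw f {..<2 * m} (verts G)"
    using ex_bij_betw_nat_finite[OF finite_verts] by (auto simp: atLeast0LessThan)
  define side where "side i b = (if b then fst (Fs ! i) else snd (Fs ! i))" for i and b :: bool
  show ?thesis
  proof (rule resolvable_decompositionI[where c = "\<lambda>i b k. f (side i b ! k)"])
    fix i assume i: "i < 2 * m - 1"
    then have c: "is_pair m (Fs ! i)"
      using pairs len by simp
    have "bij_betw (\<lambda>(b, k). side i b ! k) (UNIV \<times> {..<m}) {..<2 * m}"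
      unfolding bij_betw_def
    proof
      show "inj_on (\<lambda>(b, k). side i b ! k) (UNIV \<times> {..<m})"
        using is_pairD[OF c] by (auto simp: inj_on_def side_def nth_eq_iff_index_eq set_conv_nth split: if_splits)
      show "(\<lambda>(b, k). side i b ! k) ` (UNIV \<times> {..<m}) = {..<2 * m}"
        unfolding is_pairD(4)[OF c, symmetric] using is_pairD(1,2)[OF c]
        by (auto simp: image_iff side_def in_set_conv_nth Bex_def; blast)
    qed
    from bij_betw_trans[OF this f]
    show "bij_betw (\<lambda>(b, k). f (side i b ! k)) (UNIV \<times> {..<m}) (verts G)"
      by (simp add: comp_def split_def)
  next
    fix u v assume "u \<in> verts G" "v \<in> verts G" "u \<noteq> v"
    then have "u \<in> f ` {..<2 * m}" "v \<in> f ` {..<2 * m}"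
      using f by (simp_all add: bij_betw_imp_surj_on)
    with \<open>u \<noteq> v\<close> obtain x y where xy: "x < 2 * m" "y < 2 * m" "x \<noteq> y" "u = f x" "v = f y"
      by blast
    then obtain i where i: "i < 2 * m - 1" and arc: "(x, y) \<in> set (pair_arcs (Fs ! i))"
      using cover[of x y] len by (metis in_set_conv_nth)
    then obtain b where "(x, y) \<in> set (cycle_arcs (side i b))"
      unfolding pair_arcs_def side_def set_append by (metis (full_types) UnE)
    moreover have "length (side i b) = m"
      using is_pairD(1,2)[OF pairs[of "Fs ! i"]] i len by (simp add: side_def)
    ultimately have "\<exists>b. \<exists>k<m. x = side i b ! k \<and> y = side i b ! (Suc k mod m)"
      unfolding set_cycle_arcs by blast
    then show "\<exists>i<2 * m - 1. \<exists>b. \<exists>k<m. u = f (side i b ! k) \<and> v = f (side i b ! (Suc k mod m))"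
      using i xy by blast
  qed (use \<open>m \<ge> 2\<close> G in simp_all)
qed

section \<open>Translations of the residues modulo \<open>n\<close> that fix the points at
  infinity\<close>

definition translate :: "nat \<Rightarrow> nat \<Rightarrow> nat \<Rightarrow> nat" where
  "translate n t x = (if x < n then (x + t) mod n else x)"

text \<open>Translation is a permutation of the residues and the identity on the \<open>l\<close>
  points above them.\<close>

lemma translate_image: "translate n t ` {..<n + l} = {..<n + l}"
proof
  show "translate n t ` {..<n + l} \<subseteq> {..<n + l}"
  proof
    fix y assume "y \<in> translate n t ` {..<n + l}"
    then obtain x where x: "x < n + l" "y = translate n t x" by auto
    show "y \<in> {..<n + l}"
    proof (cases "x < n")
      case True
      then have "(x + t) mod n < n" by auto
      then show ?thesis using x True by (simp add: translate_def trans_less_add1)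
    qed (use x in \<open>simp add: translate_def\<close>)
  qed
next
  show "{..<n + l} \<subseteq> translate n t ` {..<n + l}"
  proof
    fix y assume y: "y \<in> {..<n + l}"
    show "y \<in> translate n t ` {..<n + l}"
    proof (cases "y < n")
      case True
      \<comment> \<open>The preimage is \<open>y - t\<close>; adding \<open>n - t mod n\<close>
        expresses it without truncated subtraction.\<close>
      define x where "x = (y + (n - t mod n)) mod n"
      have "x < n" using True by (auto simp: x_def)
      have "t mod n \<le> n" using True by (simp add: less_imp_le)
      then have "y + (n - t mod n) + t mod n = y + n" by simp
      then have "(x + t) mod n = y"
        using True unfolding x_def by (metis mod_add_left_eq mod_add_right_eq mod_add_self2 mod_less)
      then have "translate n t x = y"
        using \<open>x < n\<close> by (simp add: translate_def)
      then show ?thesis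
        using \<open>x < n\<close> by (intro image_eqI[of _ _ x]) auto
    next
      case False
      then show ?thesis
        using y by (intro image_eqI[of _ _ y]) (simp_all add: translate_def)
    qed
  qed
qed

section \<open>The zigzag starter\<close>

text \<open>Vertices \<open>n = 2m - 2\<close> and \<open>n + 1\<close> play the role of two points at infinity. The zigzag
  \<open>0, 1, -1, 2, -2, \<dots>\<close> runs through \<open>\<int>\<^sub>n\<close> with successive differences \<open>1, -2, 3, -4, \<dots>\<close>, hence
  all distinct; the arc removed in the middle is the one of difference \<open>n / 2 = m - 1\<close>.\<close>

definition zigzag :: "nat \<Rightarrow> nat \<Rightarrow> nat" where
  "zigzag n i = (if even i then (n - i div 2) mod n else Suc i div 2)"

definition starter :: "nat \<Rightarrow> nat cycle_pair" where
  "starter m = (let n = 2 * m - 2 in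
     (n # map (zigzag n) [0..<m - 1], Suc n # map (zigzag n) [m - 1..<n]))"

definition leftover :: "nat \<Rightarrow> (nat \<times> nat) list" where
  "leftover m = (let n = 2 * m - 2 in
     (n, Suc n) # (Suc n, n) # map (\<lambda>x. (x, (x + (m - 1)) mod n)) [0..<n])"

definition translated_starter :: "nat \<Rightarrow> nat \<Rightarrow> nat cycle_pair" where
  "translated_starter m t =
     map_prod (map (translate (2 * m - 2) t)) (map (translate (2 * m - 2) t)) (starter m)"

text \<open>Arcs are flattened to two-digit numbers in base \<open>2 * m\<close>, so that the trie
  for numbers can also compare sets of arcs.\<close>

definition arc_code :: "nat \<Rightarrow> nat \<times> nat \<Rightarrow> nat" where
  "arc_code m a = 2 * m * fst a + snd a"

text \<open>The certificate: the leftover arcs together with the first few translates of the starter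
  are rearranged into one more class than there are translates.\<close>

definition rearrangement :: "nat \<Rightarrow> nat cycle_pair list \<Rightarrow> bool" where
  "rearrangement m Es \<longleftrightarrow>
     Es \<noteq> [] \<and> length Es \<le> 2 * m - 1 \<and> list_all (is_pair m) Es \<and>
     covers (map (arc_code m) (concat (map pair_arcs Es)))
       (map (arc_code m) (leftover m @
         concat (map (\<lambda>t. pair_arcs (translated_starter m t)) [0..<length Es - 1])))"

text \<open>Division with remainder recovers the arc; for this only the head has to be a valid
  digit, while the tail may be any number.\<close>

lemma arc_code_inject:
  assumes "arc_code m a = arc_code m b" "snd a < 2 * m" "snd b < 2 * m"
  shows "a = b"
proof (rule prod_eqI)
  have "arc_code m c mod (2 * m) = snd c" "arc_code m c div (2 * m) = fst c" if "snd c < 2 * m" for c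
    using that by (simp_all add: arc_code_def)
  then show "fst a = fst b" "snd a = snd b"
    using assms by metis+
qed

section \<open>The zigzag as a permutation of the residues\<close>

text \<open>Odd positions take values between 1 and \<open>n / 2\<close>, even positions take the
  value 0 or values above \<open>n / 2\<close>, so the parities cannot collide. Within one parity
  the value determines the position.\<close>

lemma zigzag_inj: 
  assumes "even n"
  shows "inj_on (zigzag n) {..<n}"
proof (rule inj_onI)
  fix i j assume ij: "i \<in> {..<n}" "j \<in> {..<n}" and eq: "zigzag n i = zigzag n j"
  have ev: "zigzag n k = (if k = 0 then 0 else n - k div 2) \<and> (zigzag n k = 0 \<or> 2 * zigzag n k > n)"
    if "even k" "k < n" for k
    using that by (auto simp: zigzag_def elim!: evenE)
  have od: "2 * zigzag n k = k + 1 \<and> 2 * zigzag n k \<le> n" if "odd k" "k < n" for k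
    using that \<open>even n\<close> by (auto simp: zigzag_def elim!: oddE evenE)
  consider "even i" "even j" | "odd i" "odd j" | "even i" "odd j" | "odd i" "even j"
    by blast
  then show "i = j"
  proof cases
    case 1
    with ev[of i] ev[of j] ij eq show ?thesis
      by (auto elim!: evenE split: if_splits)
  next
    case 2
    then have "2 * zigzag n i = i + 1" "2 * zigzag n j = j + 1"
      using od ij by auto
    with eq show ?thesis by linarith
  next
    case 3
    then have "zigzag n i = 0 \<or> 2 * zigzag n i > n" "2 * zigzag n j = j + 1" "2 * zigzag n j \<le> n"
      using ev od ij by auto
    with eq show ?thesis by linarith
  next
    case 4
    then have "zigzag n j = 0 \<or> 2 * zigzag n j > n" "2 * zigzag n i = i + 1" "2 * zigzag n i \<le> n"
      using ev od ij by auto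
    with eq show ?thesis by linarith
  qed
qed

lemma zigzag_less: "i < n \<Longrightarrow> zigzag n i < n"
  by (auto simp: zigzag_def elim!: oddE)

lemma zigzag_image:
  assumes "even n"
  shows "zigzag n ` {..<n} = {..<n}"
  by (rule card_subset_eq) (auto simp: zigzag_less card_image zigzag_inj assms)

text \<open>The two halves of the zigzag exhaust the residues, the heads of the two lists supply the
  points at infinity, and translation permutes all of them.\<close>

lemma is_pair_translated_starter:
  assumes "m \<ge> 2"
  shows "is_pair m (translated_starter m t)"
proof -
  define n where "n = 2 * m - 2"
  have n: "2 * m = n + 2" "even n" "m - 1 \<le> n"
    using assms by (auto simp: n_def)
  have "{0..<m - 1} \<union> {m - 1..<n} = {..<n}"
    using n(3) by auto
  then have "set (fst (starter m) @ snd (starter m)) = insert n (insert (Suc n) (zigzag n ` {..<n}))"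
    by (auto simp: starter_def Let_def simp flip: n_def image_Un)
  also have "\<dots> = {..<n + 2}"
    unfolding zigzag_image[OF n(2)] by auto
  finally have starter: "set (fst (starter m) @ snd (starter m)) = {..<n + 2}" .
  define c where "c = translated_starter m t"
  have c: "fst c = map (translate n t) (fst (starter m))" "snd c = map (translate n t) (snd (starter m))"
    by (simp_all add: c_def translated_starter_def n_def)
  have len: "length (fst (starter m)) = m" "length (snd (starter m)) = m"
    using assms by (simp_all add: starter_def Let_def)
  have "is_pair m c"
  proof (rule is_pairI)
    show "set (fst c @ snd c) = {..<2 * m}"
      unfolding c map_append[symmetric] set_map starter n(1) by (rule translate_image)
  qed (simp_all add: c len)
  then show ?thesis
    by (simp only: c_def)
qed

section \<open>Arcs covered by the translates of the starter\<close>

text \<open>The translation that moves \<open>x\<close> to \<open>u\<close> is by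
  \<open>u - x\<close>; the summand \<open>n\<close> keeps the subtraction from being
  truncated.\<close>

lemma translate_to:
  assumes "x < n" "u < n"
  shows "translate n ((u + n - x) mod n) x = u"
proof -
  have "translate n ((u + n - x) mod n) x = (x + (u + n - x)) mod n"
    using assms by (simp add: translate_def mod_simps)
  then show ?thesis
    using assms by simp
qed

text \<open>The step from position \<open>i\<close> has difference \<open>i + 1\<close> for even
  \<open>i\<close> and \<open>n - (i + 1)\<close> for odd \<open>i\<close>. As \<open>n\<close> is
  even, an odd \<open>d\<close> thus occurs at \<open>i = d - 1\<close> and an even \<open>d\<close>
  at \<open>i = n - d - 1\<close>.\<close>

lemma zigzag_difference:
  assumes "odd m" "m \<ge> 3" and n: "n = 2 * m - 2" and d: "0 < d" "d < n" "d \<noteq> m - 1"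
  shows "\<exists>i. Suc i < n \<and> i \<noteq> m - 2 \<and> (zigzag n i + d) mod n = zigzag n (Suc i)"
proof (cases "even d")
  case False
  then obtain j where j: "d = Suc (2 * j)" by (auto elim: oddE)
  \<comment> \<open>The deleted step starts at the odd position \<open>m - 2\<close>, so an odd
    difference, found at an even position, is never lost.\<close>
  have "odd (m - 2)"
    using assms(1,2) by simp
  then have "2 * j \<noteq> m - 2"
    by (metis dvd_triv_left)
  moreover have "(zigzag n (2 * j) + d) mod n = zigzag n (Suc (2 * j))"
  proof -
    have "(zigzag n (2 * j) + d) mod n = (n - j + d) mod n"
      by (simp add: zigzag_def mod_simps)
    also have "n - j + d = n + Suc j"
      using j d by simp
    also have "(n + Suc j) mod n = Suc j"
      using j d by (subst mod_add_self1) simp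
    finally show ?thesis
      by (simp add: zigzag_def)
  qed
  ultimately show ?thesis
    using j d by (intro exI[of _ "2 * j"]) simp
next
  case True
  then have "even (n - d)"
    using n by simp
  then obtain j where j: "n - d = 2 * j"
    by blast
  have j': "j > 0" "d = n - 2 * j" "2 * j < n"
    using j d by auto
  \<comment> \<open>Equality would give \<open>2 * j = m - 1\<close> and hence
    \<open>d = n - (m - 1) = m - 1\<close>, the excluded difference.\<close>
  have "2 * j - 1 \<noteq> m - 2"
    using assms j' by linarith
  moreover have "(zigzag n (2 * j - 1) + d) mod n = zigzag n (Suc (2 * j - 1))"
    using j' by (simp add: zigzag_def)
  ultimately show ?thesis
    using j' by (intro exI[of _ "2 * j - 1"]) simp
qed

text \<open>Inventory of the two cycles: four arcs at the points at infinity, and every zigzag step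
  except the one from position \<open>m - 2\<close>, which would join the two halves.\<close>

lemma starter_arcs:
  assumes "m \<ge> 3" and n: "n = 2 * m - 2"
  shows "(n, zigzag n 0) \<in> set (pair_arcs (starter m))"
    and "(zigzag n (m - 2), n) \<in> set (pair_arcs (starter m))"
    and "(Suc n, zigzag n (m - 1)) \<in> set (pair_arcs (starter m))"
    and "(zigzag n (n - 1), Suc n) \<in> set (pair_arcs (starter m))"
    and "Suc i < n \<Longrightarrow> i \<noteq> m - 2 \<Longrightarrow>
      (zigzag n i, zigzag n (Suc i)) \<in> set (pair_arcs (starter m))"
proof -
  define xs where "xs = fst (starter m)"
  define ys where "ys = snd (starter m)"
  have len: "length xs = m" "length ys = m"
    using assms by (simp_all add: xs_def ys_def starter_def Let_def)
  \<comment> \<open>Index 0 is taken by the point at infinity, so zigzag positions appear in the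
    lists shifted by one.\<close>
  have xs: "xs ! 0 = n" "k < m - 1 \<Longrightarrow> xs ! Suc k = zigzag n k" for k
    using assms by (simp_all add: xs_def starter_def Let_def)
  have ys: "ys ! 0 = Suc n" "k < m - 1 \<Longrightarrow> ys ! Suc k = zigzag n (m - 1 + k)" for k
    using assms by (simp_all add: ys_def starter_def Let_def)
  have arcs_xs: "(xs ! k, xs ! (Suc k mod m)) \<in> set (pair_arcs (starter m))"
    and arcs_ys: "(ys ! k, ys ! (Suc k mod m)) \<in> set (pair_arcs (starter m))" if "k < m" for k
    using that len by (auto simp: pair_arcs_def set_cycle_arcs simp flip: xs_def ys_def)
  show "(n, zigzag n 0) \<in> set (pair_arcs (starter m))"
    using arcs_xs[of 0] xs(1) xs(2)[of 0] assms by simp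
  show "(Suc n, zigzag n (m - 1)) \<in> set (pair_arcs (starter m))"
    using arcs_ys[of 0] ys(1) ys(2)[of 0] assms by simp
  have m: "m - 1 = Suc (m - 2)" "Suc (m - 1) = m" "m - 1 + (m - 2) = n - 1"
    using assms by auto
  show "(zigzag n (m - 2), n) \<in> set (pair_arcs (starter m))"
    using arcs_xs[of "m - 1"] xs(1) xs(2)[of "m - 2"] m assms by simp
  show "(zigzag n (n - 1), Suc n) \<in> set (pair_arcs (starter m))"
  proof -
    have "ys ! (m - 1) = zigzag n (n - 1)"
      using ys(2)[of "m - 2"] m(1) unfolding m(3) by simp
    then show ?thesis
      using arcs_ys[of "m - 1"] ys(1) m(2) \<open>m \<ge> 3\<close> by simp
  qed
  show "(zigzag n i, zigzag n (Suc i)) \<in> set (pair_arcs (starter m))"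
    if i: "Suc i < n" "i \<noteq> m - 2"
  proof (cases "i < m - 2")
    case True
    then show ?thesis
      using arcs_xs[of "Suc i"] xs(2)[of i] xs(2)[of "Suc i"] by simp
  next
    case False
    \<comment> \<open>Since \<open>i = m - 2\<close> is excluded, the step lies wholly in the second
      half; \<open>k\<close> is its position there.\<close>
    define k where "k = i - (m - 1)"
    have "i = m - 1 + k" "Suc k < m - 1"
      using False i n by (auto simp: k_def)
    then have "ys ! Suc k = zigzag n i" "ys ! Suc (Suc k) = zigzag n (Suc i)"
      using ys(2)[of k] ys(2)[of "Suc k"] by simp_all
    then show ?thesis
      using arcs_ys[of "Suc k"] \<open>Suc k < m - 1\<close> by simp
  qed
qed

text \<open>An arc between residues is a translate of the starter step with the same difference, and
  an arc with just one end at infinity is fixed by its type and its finite end. What no translate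
  reaches is leftover.\<close>

lemma translated_starters_cover:
  assumes "odd m" "m \<ge> 3" and u: "u < 2 * m" and v: "v < 2 * m" and "u \<noteq> v"
  shows "(u, v) \<in> set (leftover m) \<or>
    (\<exists>t<2 * m - 2. (u, v) \<in> set (pair_arcs (translated_starter m t)))"
proof -
  define n where "n = 2 * m - 2"
  have n: "2 * m = n + 2" "n > 0" "m - 1 < n" "m - 2 < n"
    using \<open>m \<ge> 3\<close> by (auto simp: n_def)
  have arcI: "\<exists>t<n. (u, v) \<in> set (pair_arcs (translated_starter m t))"
    if "(x, y) \<in> set (pair_arcs (starter m))" "t < n" "translate n t x = u" "translate n t y = v"
    for x y t
    using that unfolding translated_starter_def pair_arcs_map n_def[symmetric] by force
  have inf: "translate n t n = n" "translate n t (Suc n) = Suc n" for t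
    by (simp_all add: translate_def)
  note arcs = starter_arcs[OF \<open>m \<ge> 3\<close> n_def]
  have "u < n \<or> u = n \<or> u = Suc n" "v < n \<or> v = n \<or> v = Suc n"
    using u v n(1) by linarith+
  then consider "u < n" "v < n" | "u < n" "v = n" | "u < n" "v = Suc n" | "u = n" "v < n"
    | "u = Suc n" "v < n" | "u = n" "v = Suc n" | "u = Suc n" "v = n"
    using \<open>u \<noteq> v\<close> by blast
  then have "(u, v) \<in> set (leftover m) \<or>
    (\<exists>t<n. (u, v) \<in> set (pair_arcs (translated_starter m t)))"
  proof cases
    case 1
    define d where "d = (v + n - u) mod n"
    have ud: "(u + d) mod n = v"
    proof -
      have "u + (v + n - u) = v + n"
        using 1 by simp
      then have "(u + d) mod n = (v + n) mod n"
        unfolding d_def by (metis mod_add_right_eq)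
      then show ?thesis
        using 1 by simp
    qed
    have d: "0 < d" "d < n"
      using ud 1 \<open>u \<noteq> v\<close> n by (auto simp: d_def intro!: gr0I)
    show ?thesis
    proof (cases "d = m - 1")
      case True
      then show ?thesis
        using ud 1 by (auto simp: leftover_def Let_def simp flip: n_def)
    next
      case False
      then obtain i where i: "Suc i < n" "i \<noteq> m - 2"
        and step: "(zigzag n i + d) mod n = zigzag n (Suc i)"
        using zigzag_difference[OF assms(1,2) n_def d] by blast
      \<comment> \<open>The translation is chosen to match the tails; the heads then agree because
        both arcs have difference \<open>d\<close>.\<close>
      define t where "t = (u + n - zigzag n i) mod n"
      have "translate n t (zigzag n i) = u"
        unfolding t_def using i 1 by (intro translate_to) (auto simp: zigzag_less)
      moreover have "translate n t (zigzag n (Suc i)) = v"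
      proof -
        have "translate n t (zigzag n (Suc i)) = (zigzag n (Suc i) + t) mod n"
          using zigzag_less[OF i(1)] by (simp add: translate_def)
        also have "\<dots> = ((zigzag n i + t) mod n + d) mod n"
          unfolding step[symmetric] by (simp add: mod_simps ac_simps)
        also have "(zigzag n i + t) mod n = u"
          using \<open>translate n t (zigzag n i) = u\<close> i zigzag_less[of i n] by (simp add: translate_def)
        finally show ?thesis
          using ud by simp
      qed
      ultimately show ?thesis
        using arcI[OF arcs(5)[OF i], of t] n by (simp add: t_def)
    qed
  \<comment> \<open>With one end at infinity there is no difference to match: the starter has one
    arc of each such type, and the finite end alone determines the translation.\<close>
  next
    case 2
    then show ?thesis
      using arcI[OF arcs(2), of "(u + n - zigzag n (m - 2)) mod n"] inf n(2)
        translate_to[OF zigzag_less, of "m - 2" n u] n by simp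
  next
    case 3
    then show ?thesis
      using arcI[OF arcs(4), of "(u + n - zigzag n (n - 1)) mod n"] inf n(2)
        translate_to[OF zigzag_less, of "n - 1" n u] n by simp
  next
    case 4
    then show ?thesis
      using arcI[OF arcs(1), of "(v + n - zigzag n (0)) mod n"] inf n(2)
        translate_to[OF zigzag_less, of "0" n v] n by simp
  next
    case 5
    then show ?thesis
      using arcI[OF arcs(3), of "(v + n - zigzag n (m - 1)) mod n"] inf n(2)
        translate_to[OF zigzag_less, of "m - 1" n v] n by simp
  \<comment> \<open>The two remaining cases are the arcs between the points at infinity, both
    leftover.\<close>
  qed (auto simp: leftover_def Let_def simp flip: n_def)
  then show ?thesis
    by (simp add: n_def)
qed

text \<open>The classes in \<open>Es\<close> take the place of the first \<open>K\<close> translates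
  and the leftover arcs, and the later translates are kept. This gives
  \<open>(K + 1) + (2 * m - 2 - K) = 2 * m - 1\<close> classes.\<close>

lemma resolvable_decomposition_of_rearrangement:
  fixes G :: "('a, 'b) pre_digraph"
  assumes "odd m" "m \<ge> 3" and G: "complete_digraph (2 * m) G" and Es: "rearrangement m Es"
  shows "\<exists>\<D>. decomposition G \<D> \<and> resolvable G \<D> \<and> (\<forall>C \<in> \<D>. directed_cycle m C)"
proof (rule resolvable_decomposition_of_pairs)
  \<comment> \<open>One less than the number of new classes, because the leftover factor contributes
    a class of its own.\<close>
  define K where "K = length Es - 1"
  define Fs where "Fs = Es @ map (translated_starter m) [K..<2 * m - 2]"
  have K: "length Es = Suc K" "K \<le> 2 * m - 2"
    using Es by (auto simp: rearrangement_def K_def)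
  have pairs: "is_pair m c" if "c \<in> set Es" for c
    using that Es by (auto simp: rearrangement_def list_all_iff)
  have rearranged: "\<exists>c\<in>set Es. (u, v) \<in> set (pair_arcs c)"
    if v: "v < 2 * m" and uv: "(u, v) \<in> set (leftover m) \<or>
      (\<exists>t<K. (u, v) \<in> set (pair_arcs (translated_starter m t)))" for u v
  proof -
    let ?removed = "leftover m @ concat (map (\<lambda>t. pair_arcs (translated_starter m t)) [0..<K])"
    have "arc_code m ` set ?removed \<subseteq> arc_code m ` set (concat (map pair_arcs Es))"
      using Es by (simp only: rearrangement_def covers_def K_def set_map)
    moreover have "(u, v) \<in> set ?removed"
      using uv by auto
    ultimately have "arc_code m (u, v) \<in> arc_code m ` set (concat (map pair_arcs Es))"
      by blast
    then obtain a c where c: "c \<in> set Es" "a \<in> set (pair_arcs c)"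
      and a: "arc_code m (u, v) = arc_code m a"
      by auto
    obtain x y where xy: "a = (x, y)"
      by fastforce
    \<comment> \<open>Equal codes give equal arcs only if both heads are below \<open>2 * m\<close>;
      for \<open>a\<close> this holds because its head is a vertex of the class
      \<open>c\<close>.\<close>
    have "snd a \<in> set (fst c @ snd c)"
      using c(2) unfolding xy by (auto simp: pair_arcs_def cycle_arcs_def dest: set_zip_rightD)
    then have "snd a < 2 * m"
      unfolding is_pairD(4)[OF pairs[OF c(1)]] by simp
    then have "a = (u, v)"
      using arc_code_inject[OF a] v by simp
    then show ?thesis
      using c by blast
  qed
  show "length Fs = 2 * m - 1"
    using K \<open>m \<ge> 3\<close> by (simp add: Fs_def)
  show "is_pair m c" if "c \<in> set Fs" for c
  proof -
    have "c \<in> set Es \<or> (\<exists>t. c = translated_starter m t)"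
      using that unfolding Fs_def set_append set_map by blast
    then show ?thesis
      using pairs[of c] is_pair_translated_starter[of m] \<open>m \<ge> 3\<close> by fastforce
  qed
  show "\<exists>c\<in>set Fs. (u, v) \<in> set (pair_arcs c)" if uv: "u < 2 * m" "v < 2 * m" "u \<noteq> v" for u v
  proof -
    consider "(u, v) \<in> set (leftover m) \<or>
        (\<exists>t<K. (u, v) \<in> set (pair_arcs (translated_starter m t)))"
      | t where "K \<le> t" "t < 2 * m - 2" "(u, v) \<in> set (pair_arcs (translated_starter m t))"
      using translated_starters_cover[OF assms(1,2) uv] not_le by blast
    then show ?thesis
    proof cases
      case 1
      then show ?thesis
        using rearranged[OF uv(2)] by (auto simp: Fs_def)
    qed (auto simp: Fs_def)
  qed
qed (use \<open>m \<ge> 3\<close> G in simp_all)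

section \<open>Rearrangements for each cycle length\<close>

text \<open>Here the residues are 0 to 7 and the points at infinity are 8 and 9. Five classes
  replace the leftover arcs and the translates by 0, 1, 2, 3; the translates by 4 to 7 stay. As in
  all the tables that follow, the claim is a finite computation on explicit lists.\<close>

lemma rearrangement_5:
  "rearrangement 5
    [([0, 7, 9, 8, 2], [1, 4, 6, 3, 5]), ([0, 5, 4, 9, 6], [1, 7, 2, 8, 3]), ([0, 3, 7, 4, 8],
     [1, 6, 2, 5, 9]), ([0, 1, 2, 3, 4], [5, 8, 9, 7, 6]), ([0, 4, 2, 6, 9], [1, 5, 7, 3, 8])]"
  by code_simp

lemma rearrangement_7:
  "rearrangement 7
    [([0, 7, 11, 8, 13, 9, 6], [1, 4, 10, 3, 12, 2, 5]), ([0, 1, 6, 10, 5, 12, 13], [2, 8, 7,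
     9, 3, 11, 4]), ([0, 6, 8, 2, 10, 9, 4], [1, 11, 5, 7, 13, 12, 3]), ([0, 5, 9, 13, 11, 6,
     12], [1, 2, 3, 4, 8, 10, 7]), ([0, 3, 9, 8, 5, 11, 2], [1, 7, 6, 13, 10, 4, 12])]"
  by code_simp

lemma rearrangement_9:
  "rearrangement 9
    [([0, 8, 17, 12, 4, 16, 3, 15, 2], [1, 6, 14, 9, 11, 10, 7, 13, 5]), ([0, 7, 15, 4, 2, 3,
     1, 9, 8], [5, 13, 10, 12, 11, 6, 16, 17, 14]), ([0, 3, 4, 12, 5, 11, 17, 13, 6], [1, 15,
     8, 14, 7, 16, 2, 10, 9]), ([0, 1, 4, 14, 6, 10, 2, 5, 16], [3, 13, 8, 12, 9, 17, 15, 7,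
     11]), ([0, 5, 15, 6, 12, 7, 9, 13, 4], [1, 2, 14, 3, 11, 8, 10, 17, 16])]"
  by code_simp

lemma rearrangement_11:
  "rearrangement 11
    [([0, 1, 4, 16, 5, 15, 10, 14, 9, 19, 6], [2, 18, 3, 17, 7, 13, 8, 12, 11, 21, 20]), ([0,
     3, 1, 19, 2, 5, 17, 4, 18, 7, 20], [6, 14, 11, 10, 12, 9, 13, 21, 15, 8, 16]), ([0, 5,
     20, 1, 11, 15, 6, 16, 9, 17, 10], [2, 3, 13, 12, 21, 18, 8, 14, 7, 19, 4]), ([0, 10, 16,
     7, 15, 5, 1, 2, 12, 14, 4], [3, 19, 8, 20, 21, 17, 6, 18, 9, 11, 13]), ([0, 7, 17, 8, 18,
     5, 19, 9, 15, 12, 2], [1, 6, 20, 3, 4, 14, 13, 10, 21, 16, 11])]"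
  by code_simp

lemma rearrangement_13:
  "rearrangement 13
    [([0, 7, 23, 2, 5, 1, 13, 17, 12, 18, 11, 19, 6], [3, 4, 22, 10, 14, 16, 15, 25, 20, 9,
     21, 8, 24]), ([0, 12, 25, 18, 6, 22, 5, 17, 10, 16, 11, 23, 4], [1, 2, 14, 13, 15, 3, 21,
     9, 19, 8, 20, 7, 24]), ([0, 3, 15, 14, 11, 13, 1, 23, 6, 20, 5, 19, 12], [2, 22, 9, 24,
     25, 21, 10, 18, 7, 17, 8, 16, 4]), ([0, 1, 6, 18, 9, 17, 5, 21, 4, 16, 13, 25, 24], [2,
     3, 23, 8, 22, 7, 19, 10, 20, 11, 15, 12, 14]), ([0, 5, 23, 11, 17, 14, 25, 19, 7, 21, 6,
     24, 2], [1, 4, 20, 8, 18, 13, 12, 16, 9, 15, 10, 22, 3])]"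
  by code_simp

lemma rearrangement_15:
  "rearrangement 15
    [([0, 1, 27, 13, 21, 12, 20, 9, 23, 10, 18, 15, 17, 3, 4], [2, 5, 25, 6, 26, 7, 28, 29,
     22, 8, 24, 11, 19, 14, 16]), ([0, 3, 25, 8, 22, 11, 17, 14, 18, 4, 24, 7, 21, 10, 28],
     [1, 6, 20, 13, 27, 2, 16, 15, 29, 23, 9, 19, 12, 26, 5]), ([0, 14, 20, 11, 25, 4, 18, 13,
     17, 16, 29, 21, 7, 27, 6], [1, 15, 19, 10, 24, 5, 23, 8, 26, 12, 22, 9, 28, 2, 3]), ([0,
     5, 19, 16, 13, 15, 1, 4, 2, 26, 9, 25, 11, 21, 14], [3, 27, 8, 20, 6, 24, 10, 22, 7, 23,
     12, 18, 17, 29, 28]), ([0, 7, 25, 10, 20, 15, 14, 29, 24, 9, 21, 8, 28, 1, 2], [3, 17,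
     12, 16, 18, 11, 23, 6, 22, 13, 19, 5, 27, 4, 26])]"
  by code_simp

lemma rearrangement_17:
  "rearrangement 17
    [([0, 3, 4, 30, 5, 29, 6, 28, 7, 27, 10, 26, 11, 21, 12, 32, 2], [1, 8, 24, 9, 31, 15, 19,
     14, 20, 33, 25, 16, 22, 13, 23, 18, 17]), ([0, 5, 27, 11, 23, 14, 30, 7, 1, 31, 10, 22,
     6, 26, 9, 32, 4], [2, 3, 29, 13, 21, 16, 33, 24, 15, 25, 8, 28, 12, 20, 17, 19, 18]),
     ([0, 1, 6, 2, 5, 21, 18, 22, 15, 31, 4, 28, 9, 23, 7, 29, 8], [3, 19, 33, 27, 12, 24, 17,
     16, 20, 13, 25, 14, 26, 10, 30, 11, 32]), ([0, 7, 31, 2, 18, 33, 28, 5, 3, 6, 30, 9, 29,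
     4, 20, 19, 16], [1, 17, 21, 14, 24, 13, 27, 8, 26, 15, 23, 12, 22, 11, 25, 10, 32]), ([0,
     16, 18, 20, 15, 21, 5, 31, 8, 32, 33, 26, 7, 25, 9, 27, 6], [1, 4, 2, 30, 14, 22, 17, 23,
     10, 24, 11, 29, 12, 28, 13, 19, 3]), ([0, 9, 25, 12, 26, 13, 29, 10, 28, 11, 27, 14, 18,
     15, 17, 33, 32], [1, 2, 7, 23, 16, 24, 8, 30, 3, 31, 6, 22, 19, 21, 20, 4, 5])]"
  by code_simp

lemma rearrangement_19:
  "rearrangement 19
    [([0, 3, 33, 15, 21, 16, 26, 8, 32, 5, 23, 18, 20, 22, 17, 25, 7, 35, 6], [1, 4, 2, 34, 9,
     31, 13, 29, 12, 28, 10, 36, 37, 30, 11, 27, 14, 24, 19]), ([0, 1, 2, 20, 37, 27, 9, 33,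
     8, 28, 15, 25, 14, 26, 11, 36, 3, 21, 18], [4, 32, 7, 29, 10, 30, 12, 24, 13, 31, 6, 34,
     5, 35, 17, 19, 23, 16, 22]), ([0, 7, 31, 10, 28, 13, 25, 12, 26, 15, 33, 4, 22, 21, 20,
     19, 18, 37, 36], [1, 6, 24, 17, 23, 14, 32, 11, 29, 8, 30, 9, 27, 16, 34, 3, 35, 2, 5]),
     ([0, 18, 24, 15, 27, 10, 32, 14, 22, 19, 37, 28, 9, 29, 11, 25, 16, 20, 2], [1, 35, 8,
     26, 17, 21, 3, 4, 34, 7, 33, 6, 30, 13, 23, 5, 31, 12, 36]), ([0, 5, 33, 10, 26, 13, 27,
     12, 30, 7, 25, 18, 22, 15, 23, 20, 17, 35, 4], [1, 19, 21, 37, 29, 14, 28, 11, 31, 8, 34,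
     16, 24, 6, 32, 9, 36, 2, 3])]"
  by code_simp

lemma rearrangement_21:
  "rearrangement 21
    [([0, 3, 23, 18, 38, 9, 35, 8, 32, 15, 31, 16, 28, 19, 25, 20, 22, 41, 30, 10, 40], [1, 4,
     24, 17, 27, 7, 39, 2, 5, 37, 6, 36, 11, 33, 13, 29, 12, 34, 14, 26, 21]), ([0, 1, 6, 38,
     7, 33, 14, 30, 15, 35, 12, 40, 41, 32, 9, 29, 18, 28, 13, 27, 20], [2, 22, 24, 19, 21,
     23, 3, 39, 8, 34, 11, 31, 10, 36, 5, 25, 16, 26, 17, 37, 4]), ([0, 7, 27, 18, 22, 21, 41,
     31, 14, 32, 12, 28, 17, 29, 9, 33, 10, 34, 13, 40, 2], [1, 39, 6, 26, 19, 23, 20, 24, 4,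
     38, 3, 37, 8, 36, 16, 30, 11, 35, 15, 25, 5]), ([0, 20, 41, 40, 3, 1, 2, 38, 5, 35, 10,
     32, 11, 29, 16, 24, 21, 25, 18, 26, 6], [4, 36, 9, 31, 12, 30, 13, 33, 8, 28, 15, 27, 14,
     34, 7, 37, 17, 23, 22, 19, 39]), ([0, 5, 39, 19, 27, 16, 36, 7, 35, 6, 34, 9, 37, 10, 30,
     17, 25, 22, 2, 3, 4], [1, 21, 20, 26, 15, 29, 14, 28, 8, 38, 18, 24, 23, 41, 33, 12, 32,
     13, 31, 11, 40])]"
  by code_simp

lemma rearrangement_23:
  "rearrangement 23
    [([0, 22, 45, 44, 4, 42, 11, 35, 18, 32, 15, 33, 20, 26, 25, 3, 6, 28, 17, 31, 9, 43, 2],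
     [1, 23, 27, 24, 21, 29, 16, 30, 8, 36, 13, 37, 12, 38, 7, 39, 14, 34, 19, 41, 10, 40,
     5]), ([0, 5, 41, 6, 40, 11, 37, 16, 36, 9, 35, 13, 39, 17, 27, 22, 26, 45, 33, 18, 34,
     12, 44], [1, 8, 38, 15, 31, 14, 30, 23, 25, 20, 42, 3, 4, 2, 24, 28, 21, 43, 10, 32, 19,
     29, 7]), ([0, 7, 43, 8, 30, 19, 27, 5, 39, 6, 42, 9, 41, 4, 40, 18, 28, 23, 1, 2, 3, 25,
     22], [10, 36, 11, 33, 12, 32, 17, 29, 20, 24, 26, 21, 31, 16, 34, 15, 44, 45, 37, 14, 38,
     13, 35]), ([0, 9, 37, 15, 35, 12, 36, 14, 32, 10, 38, 16, 28, 25, 27, 18, 26, 4, 5, 3, 1,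
     43, 6], [2, 42, 7, 41, 19, 31, 20, 30, 21, 23, 29, 22, 24, 45, 34, 17, 33, 11, 39, 8, 40,
     13, 44]), ([0, 1, 6, 38, 11, 41, 12, 34, 13, 31, 22, 30, 17, 35, 16, 32, 21, 25, 24, 2,
     7, 37, 8], [3, 43, 4, 26, 23, 45, 36, 15, 29, 18, 40, 9, 39, 10, 42, 5, 27, 20, 28, 19,
     33, 14, 44]), ([0, 3, 41, 8, 42, 20, 32, 13, 33, 16, 38, 9, 31, 18, 30, 15, 37, 10, 34,
     11, 44, 1, 4], [2, 5, 43, 21, 27, 26, 19, 25, 45, 35, 14, 36, 17, 39, 12, 40, 7, 29, 24,
     23, 22, 28, 6])]"
  by code_simp

lemma rearrangement_25:
  "rearrangement 25
    [([0, 1, 8, 46, 13, 37, 14, 34, 10, 42, 15, 33, 9, 39, 20, 28, 4, 44, 7, 43, 6, 2, 3, 27,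
     24], [5, 45, 21, 35, 18, 38, 19, 29, 22, 32, 17, 41, 16, 36, 12, 40, 11, 47, 23, 31, 26,
     30, 25, 49, 48]), ([0, 11, 41, 14, 36, 19, 37, 16, 38, 17, 33, 26, 28, 23, 25, 29, 24,
     34, 21, 31, 20, 32, 27, 3, 4], [1, 2, 7, 47, 8, 44, 15, 35, 22, 46, 5, 43, 10, 40, 13,
     45, 12, 48, 49, 39, 18, 30, 6, 42, 9]), ([0, 3, 45, 4, 46, 11, 35, 16, 40, 17, 31, 7, 1,
     6, 44, 20, 30, 19, 39, 10, 38, 14, 42, 13, 48], [2, 9, 43, 8, 32, 25, 33, 24, 49, 41, 18,
     34, 23, 29, 5, 47, 12, 36, 15, 37, 22, 28, 21, 27, 26]), ([0, 5, 6, 46, 3, 1, 25, 31, 24,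
     30, 23, 35, 20, 36, 17, 37, 13, 43, 19, 33, 18, 40, 16, 32, 8], [2, 26, 49, 38, 21, 29,
     28, 27, 22, 34, 15, 39, 12, 42, 11, 45, 14, 48, 4, 7, 41, 10, 44, 9, 47]), ([0, 7, 31,
     28, 25, 27, 49, 37, 18, 32, 21, 45, 6, 30, 29, 20, 34, 19, 35, 24, 26, 23, 47, 4, 2], [1,
     10, 46, 9, 33, 22, 36, 13, 41, 12, 38, 11, 39, 14, 44, 5, 3, 8, 40, 15, 43, 16, 42, 17,
     48]), ([0, 24, 28, 49, 36, 23, 27, 31, 18, 42, 7, 45, 8, 2, 46, 22, 30, 21, 33, 16, 34,
     25, 1, 47, 10], [3, 6, 4, 5, 29, 26, 32, 19, 43, 12, 44, 11, 37, 20, 38, 13, 35, 14, 40,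
     9, 41, 17, 39, 15, 48]), ([0, 9, 45, 10, 34, 17, 35, 11, 43, 14, 38, 15, 41, 8, 42, 18,
     36, 21, 37, 12, 46, 7, 3, 47, 6], [1, 4, 28, 30, 27, 29, 49, 40, 19, 31, 22, 26, 25, 24,
     32, 23, 33, 20, 44, 13, 39, 16, 48, 2, 5])]"
  by code_simp

lemma rearrangement_27:
  "rearrangement 27
    [([0, 7, 33, 24, 32, 21, 39, 14, 40, 13, 41, 18, 38, 23, 29, 3, 4, 30, 27, 31, 26, 28, 2,
     50, 11, 49, 6], [1, 51, 8, 34, 25, 35, 20, 46, 9, 47, 12, 44, 15, 45, 16, 42, 17, 52, 53,
     43, 10, 36, 19, 37, 22, 48, 5]), ([0, 5, 47, 14, 44, 9, 51, 4, 48, 22, 30, 29, 53, 40,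
     17, 35, 24, 34, 21, 37, 18, 36, 23, 31, 28, 27, 26], [1, 6, 32, 25, 33, 20, 38, 15, 43,
     16, 52, 2, 3, 49, 8, 46, 11, 41, 12, 42, 19, 39, 13, 45, 10, 50, 7]), ([0, 9, 35, 26, 32,
     23, 33, 28, 25, 31, 22, 36, 17, 43, 14, 46, 7, 51, 6, 50, 3, 29, 24, 30, 53, 52, 4], [1,
     2, 5, 49, 12, 40, 19, 45, 8, 48, 13, 39, 18, 42, 15, 41, 16, 38, 21, 47, 10, 44, 11, 37,
     20, 34, 27]), ([0, 1, 27, 53, 41, 20, 32, 29, 26, 34, 23, 49, 4, 50, 5, 31, 24, 36, 21,
     35, 18, 40, 14, 42, 11, 47, 8], [2, 28, 30, 25, 51, 10, 48, 9, 43, 17, 39, 22, 38, 19,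
     33, 7, 45, 12, 46, 15, 37, 16, 44, 13, 52, 3, 6]), ([0, 3, 1, 8, 44, 18, 34, 19, 35, 22,
     32, 27, 33, 26, 30, 4, 2, 7, 49, 23, 37, 24, 50, 9, 45, 14, 52], [5, 51, 25, 29, 28, 53,
     42, 13, 47, 6, 48, 11, 43, 12, 38, 17, 41, 15, 39, 16, 36, 10, 46, 20, 40, 21, 31]), ([0,
     26, 53, 39, 20, 36, 25, 27, 29, 31, 30, 23, 35, 9, 49, 10, 42, 16, 40, 15, 52, 1, 4, 5,
     3, 51, 2], [6, 46, 13, 43, 18, 44, 17, 37, 11, 45, 19, 41, 14, 38, 12, 48, 7, 47, 21, 33,
     22, 34, 8, 50, 24, 28, 32])]"
  by code_simp

lemma rearrangement_29:
  "rearrangement 29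
    [([0, 11, 47, 12, 48, 20, 46, 18, 38, 23, 39, 28, 30, 29, 57, 45, 17, 41, 13, 53, 14, 44,
     19, 43, 16, 42, 21, 49, 10], [1, 6, 50, 15, 56, 2, 7, 51, 8, 54, 3, 31, 26, 32, 34, 33,
     24, 40, 27, 35, 22, 36, 25, 37, 9, 55, 4, 52, 5]), ([0, 5, 6, 52, 9, 1, 10, 46, 13, 47,
     20, 42, 25, 33, 32, 29, 35, 26, 40, 12, 54, 11, 55, 2, 3, 4, 7, 53, 8], [14, 50, 17, 39,
     24, 38, 27, 37, 30, 34, 31, 28, 36, 21, 45, 22, 44, 23, 51, 16, 48, 19, 41, 18, 56, 57,
     43, 15, 49]), ([0, 1, 8, 2, 54, 9, 51, 23, 37, 20, 48, 13, 41, 16, 40, 19, 47, 10, 50,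
     11, 39, 26, 36, 29, 28, 34, 25, 53, 6], [3, 55, 27, 33, 30, 32, 31, 57, 46, 17, 45, 12,
     44, 15, 43, 22, 38, 21, 35, 24, 52, 7, 49, 18, 42, 14, 56, 4, 5]), ([0, 28, 57, 47, 18,
     46, 19, 45, 14, 52, 11, 53, 4, 32, 25, 35, 7, 1, 29, 37, 26, 34, 27, 55, 8, 36, 31, 30,
     2], [3, 6, 54, 13, 43, 20, 38, 10, 48, 15, 41, 24, 42, 23, 33, 5, 51, 12, 50, 9, 49, 16,
     44, 21, 39, 22, 40, 17, 56]), ([0, 3, 8, 52, 15, 47, 14, 42, 17, 49, 12, 46, 11, 45, 16,
     56, 5, 55, 6, 34, 29, 1, 4, 2, 30, 27, 31, 33, 28], [7, 35, 32, 57, 44, 13, 51, 10, 54,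
     26, 38, 19, 39, 20, 40, 21, 37, 24, 36, 23, 43, 18, 48, 9, 53, 25, 41, 22, 50]), ([0, 9,
     37, 22, 34, 23, 41, 20, 36, 27, 39, 11, 49, 8, 50, 13, 45, 18, 44, 16, 46, 21, 43, 14,
     48, 17, 47, 19, 56], [1, 55, 12, 40, 25, 31, 35, 28, 38, 29, 33, 26, 30, 57, 42, 15, 51,
     6, 2, 5, 53, 10, 52, 24, 32, 4, 54, 7, 3]), ([0, 7, 55, 10, 38, 25, 39, 18, 40, 23, 35,
     30, 36, 8, 48, 11, 51, 14, 46, 15, 45, 20, 44, 17, 43, 24, 34, 6, 4], [1, 2, 9, 47, 16,
     50, 22, 42, 19, 37, 28, 32, 27, 29, 31, 3, 53, 12, 52, 13, 49, 21, 41, 26, 54, 5, 33, 57,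
     56])]"
  by code_simp

lemma rearrangement_31:
  "rearrangement 31
    [([0, 11, 51, 10, 58, 5, 1, 4, 7, 59, 29, 41, 28, 34, 61, 47, 22, 46, 15, 60, 2, 32, 36,
     35, 30, 40, 23, 39, 9, 55, 6], [3, 8, 52, 13, 43, 18, 50, 19, 49, 16, 44, 27, 57, 14, 48,
     21, 45, 20, 42, 25, 37, 24, 54, 17, 53, 12, 56, 26, 38, 31, 33]), ([0, 5, 59, 12, 42, 27,
     43, 20, 50, 11, 57, 10, 56, 15, 51, 21, 41, 30, 61, 49, 14, 44, 19, 47, 18, 48, 17, 60,
     3, 4, 2], [1, 31, 39, 24, 46, 16, 52, 22, 40, 25, 35, 32, 38, 33, 28, 36, 6, 54, 13, 53,
     23, 45, 26, 34, 29, 37, 7, 55, 8, 58, 9]), ([0, 1, 10, 40, 21, 49, 20, 46, 25, 45, 22,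
     42, 19, 43, 24, 44, 17, 51, 18, 60, 5, 57, 12, 52, 9, 39, 30, 38, 29, 59, 4], [2, 58, 28,
     32, 31, 61, 48, 23, 37, 26, 56, 13, 47, 16, 50, 15, 55, 14, 54, 7, 3, 6, 36, 33, 35, 34,
     27, 41, 11, 53, 8]), ([0, 3, 57, 4, 58, 7, 37, 28, 40, 10, 54, 9, 59, 8, 38, 25, 43, 13,
     55, 12, 48, 15, 53, 16, 46, 21, 39, 32, 34, 33, 30], [1, 2, 5, 6, 56, 11, 49, 22, 52, 19,
     51, 14, 50, 17, 47, 20, 60, 61, 45, 18, 44, 23, 41, 24, 36, 27, 35, 26, 42, 29, 31]),
     ([0, 7, 57, 6, 4, 34, 31, 35, 5, 55, 25, 39, 22, 44, 21, 47, 14, 46, 19, 41, 26, 40, 27,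
     37, 30, 36, 29, 33, 32, 61, 60], [1, 8, 56, 9, 53, 10, 52, 17, 49, 18, 42, 12, 50, 20,
     48, 13, 51, 16, 54, 15, 45, 24, 38, 23, 43, 28, 58, 11, 59, 2, 3]), ([0, 9, 51, 20, 44,
     14, 52, 11, 55, 16, 48, 19, 60, 1, 6, 2, 7, 53, 18, 46, 23, 47, 17, 45, 15, 49, 12, 58,
     3, 59, 10], [4, 56, 5, 35, 61, 50, 13, 57, 8, 54, 24, 40, 31, 30, 32, 29, 39, 28, 42, 21,
     43, 26, 36, 25, 41, 22, 38, 27, 33, 37, 34]), ([0, 30, 34, 36, 31, 37, 32, 2, 9, 57, 27,
     39, 26, 44, 25, 55, 10, 50, 21, 51, 12, 54, 11, 41, 20, 40, 29, 35, 28, 38, 8], [1, 59,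
     6, 58, 13, 49, 19, 45, 16, 60, 4, 5, 3, 33, 61, 46, 17, 43, 22, 48, 18, 52, 15, 47, 24,
     42, 23, 53, 14, 56, 7])]"
  by code_simp

lemma rearrangement_33:
  "rearrangement 33
    [([0, 32, 42, 37, 28, 36, 33, 39, 38, 27, 51, 16, 56, 19, 57, 22, 64, 3, 4, 62, 5, 59, 20,
     48, 23, 55, 18, 46, 29, 49, 17, 53, 14], [1, 6, 2, 9, 61, 10, 60, 7, 8, 58, 26, 52, 15,
     47, 24, 44, 31, 35, 43, 30, 40, 25, 41, 34, 65, 50, 21, 45, 13, 63, 12, 54, 11]), ([0,
     13, 45, 32, 36, 40, 29, 43, 28, 50, 18, 58, 17, 61, 16, 64, 65, 53, 22, 42, 27, 47, 20,
     52, 25, 51, 19, 59, 12, 62, 9, 63, 4], [1, 14, 46, 21, 57, 10, 56, 11, 55, 24, 54, 23,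
     41, 30, 44, 33, 35, 3, 6, 38, 37, 34, 2, 5, 8, 60, 15, 49, 26, 48, 31, 39, 7]), ([0, 1,
     12, 44, 29, 35, 32, 65, 48, 25, 53, 21, 55, 16, 54, 19, 47, 30, 46, 14, 60, 17, 51, 22,
     56, 24, 52, 20, 58, 13, 57, 18, 64], [2, 3, 61, 6, 9, 41, 38, 33, 37, 39, 34, 31, 45, 26,
     50, 15, 59, 8, 62, 7, 5, 10, 4, 36, 42, 23, 49, 28, 40, 27, 43, 11, 63]), ([0, 9, 5, 61,
     4, 60, 28, 48, 21, 53, 26, 42, 10, 58, 19, 49, 18, 52, 23, 64, 7, 3, 63, 31, 37, 32, 38,
     35, 41, 24, 40, 8, 6], [1, 33, 45, 22, 46, 27, 59, 16, 50, 29, 39, 30, 62, 11, 43, 36,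
     65, 51, 20, 56, 17, 47, 15, 55, 12, 2, 34, 44, 25, 57, 14, 54, 13]), ([0, 5, 1, 8, 4, 7,
     57, 16, 58, 11, 3, 35, 34, 38, 6, 60, 19, 64, 2, 62, 13, 51, 26, 40, 37, 41, 9, 59, 10,
     42, 29, 61, 12], [14, 52, 21, 43, 24, 50, 27, 45, 28, 46, 33, 65, 49, 30, 36, 31, 47, 22,
     48, 17, 55, 20, 54, 25, 39, 32, 44, 23, 53, 18, 56, 15, 63]), ([0, 15, 51, 24, 56, 9, 3,
     1, 10, 2, 7, 59, 18, 54, 17, 57, 12, 60, 13, 55, 14, 58, 21, 47, 28, 44, 35, 65, 64, 4,
     11, 61, 8], [5, 63, 6, 62, 30, 42, 33, 32, 46, 23, 43, 22, 52, 27, 49, 16, 48, 19, 53,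
     20, 50, 25, 45, 34, 40, 39, 26, 38, 31, 41, 36, 29, 37]), ([0, 11, 59, 27, 37, 36, 38,
     40, 35, 39, 65, 55, 10, 54, 15, 57, 20, 46, 25, 43, 26, 58, 9, 1, 4, 2, 13, 53, 24, 48,
     29, 47, 32], [3, 8, 56, 21, 49, 22, 44, 12, 52, 19, 51, 14, 50, 23, 45, 30, 34, 33, 41,
     28, 42, 31, 63, 16, 62, 17, 64, 6, 7, 61, 18, 60, 5]), ([0, 3, 12, 58, 7, 63, 10, 62, 15,
     53, 16, 52, 17, 59, 14, 56, 13, 61, 29, 41, 26, 44, 21, 51, 28, 60, 11, 57, 8, 40, 33, 1,
     2], [4, 9, 55, 23, 47, 18, 48, 27, 39, 36, 35, 37, 30, 38, 65, 54, 22, 50, 19, 45, 24,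
     46, 31, 43, 32, 34, 42, 25, 49, 20, 64, 5, 6]), ([0, 7, 39, 28, 38, 29, 45, 20, 44, 27,
     41, 32, 40, 31, 33, 43, 34, 36, 4, 5, 37, 65, 52, 13, 59, 6, 58, 15, 61, 14, 62, 3, 10],
     [1, 63, 8, 2, 11, 53, 12, 56, 23, 51, 18, 50, 17, 49, 24, 42, 35, 30, 48, 16, 60, 9, 57,
     25, 47, 26, 46, 19, 55, 22, 54, 21, 64])]"
  by code_simp

lemma rearrangement_35:
  "rearrangement 35
    [([0, 7, 41, 69, 54, 17, 59, 25, 45, 30, 64, 19, 57, 20, 56, 21, 61, 27, 55, 16, 62, 9,
     43, 40, 42, 39, 5, 8, 66, 32, 36, 2, 13, 67, 6], [1, 10, 58, 15, 63, 14, 60, 26, 44, 35,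
     47, 28, 52, 31, 51, 24, 48, 23, 53, 18, 68, 3, 65, 12, 46, 29, 49, 22, 50, 33, 37, 34,
     38, 4, 11]), ([0, 1, 6, 66, 9, 67, 8, 2, 5, 3, 12, 64, 11, 65, 14, 56, 15, 55, 24, 58,
     17, 51, 18, 62, 13, 63, 16, 52, 19, 53, 30, 46, 25, 59, 10], [4, 7, 61, 20, 54, 23, 57,
     26, 48, 33, 35, 41, 28, 42, 29, 43, 32, 50, 27, 47, 22, 60, 21, 49, 34, 44, 39, 36, 40,
     31, 37, 45, 38, 69, 68]), ([0, 11, 63, 8, 6, 62, 19, 68, 69, 57, 12, 66, 13, 47, 30, 38,
     31, 41, 40, 33, 45, 32, 46, 35, 39, 34, 36, 42, 37, 3, 1, 2, 7, 67, 4], [5, 65, 16, 54,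
     27, 49, 20, 58, 24, 52, 18, 60, 15, 61, 10, 64, 17, 55, 22, 56, 23, 59, 14, 48, 29, 51,
     26, 50, 21, 53, 28, 44, 25, 43, 9]), ([0, 3, 67, 2, 11, 59, 22, 58, 23, 45, 28, 40, 29,
     39, 43, 38, 33, 47, 34, 42, 41, 36, 44, 37, 32, 48, 35, 69, 56, 13, 55, 21, 68, 1, 12],
     [4, 9, 61, 16, 66, 5, 10, 60, 19, 49, 26, 54, 15, 57, 14, 64, 30, 52, 25, 53, 24, 46, 27,
     51, 20, 62, 17, 63, 18, 50, 31, 65, 6, 7, 8]), ([0, 13, 57, 24, 68, 2, 9, 3, 6, 4, 66,
     15, 65, 18, 64, 5, 63, 10, 44, 31, 49, 30, 40, 39, 38, 37, 69, 58, 11, 45, 26, 60, 17,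
     61, 8], [1, 35, 43, 36, 33, 67, 12, 56, 19, 59, 16, 50, 25, 55, 20, 52, 29, 41, 34, 48,
     14, 54, 21, 47, 32, 42, 27, 53, 22, 46, 23, 51, 28, 62, 7]), ([0, 5, 39, 30, 50, 19, 51,
     22, 48, 27, 45, 36, 35, 34, 46, 37, 43, 28, 54, 25, 49, 15, 67, 33, 41, 32, 40, 69, 53,
     16, 64, 7, 65, 10, 2], [1, 4, 38, 42, 31, 47, 24, 44, 29, 63, 12, 58, 13, 59, 20, 60, 11,
     61, 14, 66, 3, 8, 62, 21, 57, 18, 52, 23, 55, 26, 56, 17, 68, 6, 9]), ([0, 9, 59, 24, 54,
     20, 50, 16, 56, 25, 51, 32, 66, 11, 67, 10, 4, 64, 13, 65, 8, 42, 33, 49, 28, 48, 21, 55,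
     18, 58, 19, 63, 29, 45, 34], [1, 14, 62, 15, 53, 26, 46, 31, 43, 30, 44, 27, 61, 12, 60,
     23, 47, 36, 69, 52, 17, 57, 22, 68, 7, 5, 6, 2, 3, 37, 39, 41, 38, 40, 35]), ([0, 34, 40,
     6, 64, 15, 59, 12, 62, 11, 3, 4, 2, 36, 46, 33, 39, 69, 55, 28, 50, 23, 49, 32, 38, 44,
     10, 66, 7, 63, 20, 68, 5, 67, 14], [1, 8, 60, 9, 65, 31, 45, 24, 56, 22, 52, 27, 43, 26,
     42, 35, 37, 41, 30, 48, 25, 57, 16, 58, 21, 51, 17, 53, 19, 61, 18, 54, 29, 47, 13]),
     ([0, 15, 49, 24, 50, 29, 53, 20, 48, 31, 39, 32, 44, 33, 43, 34, 69, 51, 30, 42, 8, 64,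
     9, 63, 6, 40, 37, 36, 38, 35, 45, 11, 57, 23, 68], [1, 67, 16, 60, 13, 61, 22, 54, 19,
     55, 14, 58, 25, 47, 26, 52, 21, 59, 18, 56, 27, 41, 7, 3, 10, 62, 28, 46, 12, 2, 66, 17,
     65, 4, 5])]"
  by code_simp

lemma rearrangement_37:
  "rearrangement 37
    [([0, 5, 1, 8, 2, 38, 35, 45, 9, 69, 33, 41, 36, 40, 46, 39, 47, 28, 52, 31, 49, 32, 42,
     37, 73, 54, 29, 65, 18, 66, 19, 63, 16, 64, 11, 71, 6], [3, 10, 4, 68, 15, 51, 30, 44,
     43, 34, 70, 7, 67, 14, 60, 27, 55, 26, 50, 23, 53, 17, 61, 22, 58, 25, 57, 24, 48, 12,
     62, 13, 59, 20, 56, 21, 72]), ([0, 11, 47, 38, 2, 3, 39, 45, 34, 42, 41, 40, 73, 55, 19,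
     65, 10, 46, 35, 43, 7, 8, 70, 5, 71, 12, 68, 13, 1, 6, 9, 67, 18, 60, 23, 72, 4], [14,
     64, 17, 53, 30, 66, 15, 61, 24, 62, 26, 56, 25, 49, 28, 54, 21, 59, 16, 58, 29, 57, 20,
     52, 27, 63, 22, 50, 31, 51, 32, 44, 37, 36, 48, 33, 69]), ([0, 36, 46, 27, 53, 26, 62,
     21, 51, 28, 64, 15, 69, 10, 70, 3, 71, 4, 9, 63, 20, 54, 23, 57, 30, 50, 14, 58, 17, 59,
     22, 52, 16, 68, 11, 65, 8], [1, 37, 39, 41, 34, 48, 35, 47, 32, 40, 33, 43, 73, 60, 25,
     61, 12, 66, 7, 5, 6, 2, 13, 49, 24, 56, 19, 67, 31, 45, 38, 42, 44, 29, 55, 18, 72]),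
     ([0, 13, 67, 12, 48, 29, 53, 34, 40, 39, 43, 38, 44, 33, 51, 24, 52, 35, 71, 10, 2, 9,
     65, 16, 62, 11, 3, 1, 4, 5, 8, 64, 28, 50, 37, 49, 36], [6, 42, 73, 56, 27, 47, 26, 58,
     19, 59, 23, 55, 22, 60, 21, 61, 20, 66, 17, 63, 14, 70, 15, 57, 18, 68, 32, 46, 31, 41,
     45, 30, 54, 25, 72, 7, 69]), ([0, 3, 4, 11, 1, 2, 7, 43, 30, 42, 33, 47, 36, 50, 35, 41,
     5, 69, 16, 60, 17, 67, 20, 58, 23, 59, 24, 54, 18, 62, 15, 65, 12, 70, 34, 46, 10], [6,
     68, 19, 72, 73, 61, 14, 66, 21, 57, 26, 52, 25, 53, 32, 48, 39, 38, 37, 45, 40, 44, 31,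
     55, 28, 56, 29, 49, 13, 63, 27, 51, 22, 64, 9, 71, 8]), ([0, 15, 67, 6, 4, 7, 71, 2, 70,
     9, 1, 14, 62, 19, 53, 24, 60, 13, 65, 22, 72, 5, 10, 66, 11, 61, 16, 52, 21, 55, 30, 56,
     20, 64, 23, 63, 12], [3, 69, 8, 68, 17, 57, 28, 58, 27, 49, 26, 46, 37, 41, 73, 59, 18,
     54, 33, 45, 32, 50, 29, 51, 34, 38, 48, 25, 47, 40, 42, 31, 43, 36, 44, 35, 39]), ([0, 1,
     71, 35, 37, 47, 30, 46, 29, 43, 42, 6, 7, 65, 20, 62, 25, 51, 15, 59, 14, 50, 33, 39, 36,
     73, 58, 21, 63, 18, 64, 13, 61, 26, 60, 24, 72], [2, 11, 67, 10, 68, 5, 3, 8, 66, 9, 45,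
     28, 48, 27, 57, 16, 56, 31, 53, 22, 54, 19, 55, 32, 52, 23, 49, 34, 44, 41, 38, 40, 4,
     70, 17, 69, 12]), ([0, 9, 3, 12, 64, 19, 57, 21, 53, 28, 44, 8, 4, 2, 5, 67, 16, 70, 11,
     69, 18, 58, 22, 56, 17, 65, 29, 45, 42, 39, 73, 72, 6, 66, 13, 71, 14], [1, 10, 62, 23,
     61, 25, 55, 20, 60, 15, 63, 24, 50, 27, 59, 26, 54, 31, 47, 34, 52, 33, 49, 30, 48, 37,
     43, 40, 35, 51, 36, 38, 46, 41, 32, 68, 7]), ([0, 7, 3, 6, 70, 13, 69, 4, 40, 37, 1, 12,
     60, 19, 61, 18, 56, 23, 51, 26, 48, 31, 67, 8, 44, 39, 34, 50, 25, 59, 28, 46, 33, 53,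
     20, 72, 2], [5, 41, 43, 32, 54, 27, 45, 36, 42, 35, 49, 38, 73, 57, 22, 62, 17, 55, 24,
     58, 15, 71, 16, 66, 30, 52, 29, 47, 11, 63, 10, 64, 21, 65, 14, 68, 9])]"
  by code_simp

lemma rearrangement_39:
  "rearrangement 39
    [([0, 9, 69, 31, 51, 28, 48, 10, 74, 3, 1, 14, 68, 15, 75, 12, 70, 17, 55, 32, 54, 29, 61,
     30, 58, 27, 57, 20, 64, 23, 53, 38, 42, 46, 8, 4, 2, 5, 6], [7, 73, 18, 62, 19, 67, 16,
     72, 11, 71, 33, 45, 44, 39, 47, 34, 50, 37, 41, 43, 40, 77, 63, 22, 56, 35, 49, 36, 52,
     25, 59, 24, 66, 13, 65, 26, 60, 21, 76]), ([0, 13, 1, 6, 7, 69, 14, 70, 32, 46, 41, 49,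
     30, 48, 31, 47, 38, 40, 44, 37, 51, 26, 52, 29, 55, 34, 54, 27, 53, 15, 65, 18, 68, 11,
     75, 2, 9, 3, 8], [4, 74, 36, 50, 35, 43, 42, 39, 45, 77, 59, 20, 58, 21, 57, 19, 61, 22,
     64, 17, 67, 10, 72, 5, 73, 12, 66, 28, 62, 25, 63, 24, 56, 33, 71, 16, 60, 23, 76]), ([0,
     7, 8, 68, 23, 61, 24, 64, 26, 58, 19, 71, 12, 74, 13, 51, 36, 48, 39, 43, 5, 1, 75, 4, 9,
     73, 6, 70, 15, 67, 18, 56, 31, 55, 22, 76, 2, 3, 10], [11, 65, 20, 60, 25, 53, 30, 46,
     33, 57, 34, 52, 27, 59, 28, 54, 35, 41, 45, 40, 42, 37, 49, 38, 50, 29, 47, 32, 44, 77,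
     62, 21, 63, 14, 72, 17, 69, 16, 66]), ([0, 38, 48, 37, 39, 49, 11, 1, 4, 5, 43, 77, 60,
     31, 69, 10, 70, 7, 71, 20, 56, 21, 59, 26, 62, 23, 67, 22, 68, 9, 47, 36, 46, 45, 34, 42,
     41, 40, 2], [3, 75, 8, 6, 44, 33, 53, 24, 58, 29, 51, 32, 52, 35, 55, 28, 50, 12, 72, 13,
     73, 14, 64, 15, 63, 25, 57, 30, 54, 16, 74, 17, 65, 27, 61, 18, 66, 19, 76]), ([0, 1, 2,
     11, 49, 34, 48, 29, 53, 26, 54, 37, 47, 42, 44, 6, 4, 72, 9, 5, 75, 16, 70, 21, 67, 20,
     76, 77, 61, 28, 56, 25, 65, 24, 52, 33, 43, 45, 38], [3, 12, 64, 27, 51, 30, 60, 19, 59,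
     22, 62, 15, 71, 14, 66, 23, 55, 17, 63, 18, 58, 31, 57, 32, 50, 39, 41, 36, 40, 46, 35,
     73, 10, 68, 13, 69, 8, 74, 7]), ([0, 3, 6, 2, 40, 50, 27, 49, 32, 70, 19, 63, 16, 68, 30,
     52, 31, 45, 42, 4, 7, 5, 8, 72, 15, 61, 23, 57, 28, 58, 33, 47, 9, 67, 29, 59, 21, 65,
     12], [1, 39, 51, 38, 44, 41, 77, 64, 13, 71, 10, 48, 43, 36, 54, 25, 55, 26, 56, 18, 60,
     22, 66, 17, 73, 35, 53, 34, 46, 37, 75, 14, 74, 11, 69, 20, 62, 24, 76]), ([0, 11, 73, 8,
     46, 39, 77, 57, 22, 58, 23, 59, 32, 56, 29, 67, 14, 62, 27, 55, 24, 54, 33, 51, 40, 48,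
     41, 47, 30, 68, 19, 65, 16, 64, 25, 76, 5, 3, 4], [1, 12, 2, 7, 75, 10, 66, 21, 61, 20,
     70, 13, 63, 26, 50, 31, 49, 42, 35, 45, 36, 74, 15, 69, 18, 72, 34, 44, 43, 38, 52, 37,
     53, 28, 60, 17, 71, 6, 9]), ([0, 15, 73, 16, 62, 17, 59, 18, 70, 9, 75, 6, 74, 5, 71, 8,
     2, 13, 67, 12, 50, 33, 55, 30, 56, 27, 65, 14, 52, 39, 1, 10, 4, 11, 3, 41, 38, 77, 76],
     [7, 45, 32, 58, 20, 68, 21, 69, 22, 54, 23, 63, 28, 66, 25, 61, 26, 64, 19, 57, 24, 60,
     29, 49, 40, 37, 43, 47, 44, 46, 31, 53, 36, 42, 48, 35, 51, 34, 72]), ([0, 5, 10, 2, 74,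
     9, 71, 18, 64, 21, 55, 36, 44, 35, 47, 40, 39, 38, 46, 43, 34, 56, 23, 65, 22, 60, 27,
     63, 20, 66, 15, 53, 32, 48, 33, 49, 28, 52, 14], [1, 8, 70, 11, 67, 24, 62, 29, 57, 26,
     76, 6, 72, 19, 69, 12, 68, 17, 61, 16, 54, 31, 59, 30, 50, 41, 3, 73, 4, 42, 77, 58, 25,
     51, 13, 75, 37, 45, 7])]"
  by code_simp

lemma rearrangement_41:
  "rearrangement 41
    [([0, 7, 47, 46, 81, 66, 26, 56, 25, 63, 22, 62, 33, 49, 36, 50, 39, 55, 15, 65, 20, 80,
     6, 2, 5, 8, 78, 38, 44, 41, 1, 10, 72, 9, 3, 79, 16, 70, 11, 77, 4], [12, 76, 13, 53, 32,
     48, 45, 40, 42, 52, 35, 75, 18, 58, 37, 43, 51, 30, 64, 23, 71, 31, 61, 28, 68, 27, 57,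
     34, 74, 17, 67, 24, 60, 21, 73, 14, 54, 29, 59, 19, 69]), ([0, 15, 67, 16, 56, 31, 55,
     36, 44, 81, 65, 30, 70, 19, 75, 10, 78, 17, 57, 32, 60, 33, 53, 13, 1, 41, 40, 54, 27,
     61, 24, 58, 35, 51, 34, 52, 39, 45, 49, 46, 6], [2, 11, 73, 20, 68, 23, 59, 28, 64, 29,
     63, 26, 80, 4, 5, 3, 12, 72, 21, 71, 18, 62, 22, 66, 25, 69, 14, 76, 7, 77, 37, 47, 38,
     50, 43, 42, 48, 8, 74, 9, 79]), ([0, 11, 51, 36, 48, 41, 49, 9, 71, 24, 56, 16, 66, 17,
     63, 18, 76, 5, 77, 8, 6, 7, 3, 4, 78, 15, 73, 22, 58, 25, 61, 32, 72, 23, 69, 20, 70, 13,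
     75, 12, 2], [1, 14, 68, 28, 54, 31, 53, 42, 50, 33, 55, 38, 52, 37, 57, 30, 62, 29, 65,
     26, 60, 35, 45, 47, 40, 44, 43, 81, 64, 21, 59, 34, 46, 39, 79, 10, 74, 19, 67, 27, 80]),
     ([0, 5, 10, 70, 17, 71, 16, 76, 9, 1, 6, 78, 11, 3, 77, 14, 74, 21, 65, 25, 67, 20, 72,
     15, 75, 8, 4, 2, 42, 41, 53, 34, 54, 39, 51, 38, 48, 43, 40, 81, 80], [7, 79, 12, 52, 31,
     57, 24, 62, 23, 61, 22, 64, 19, 63, 30, 60, 29, 69, 26, 66, 27, 55, 28, 58, 18, 68, 13,
     73, 33, 59, 32, 56, 37, 49, 44, 50, 45, 36, 46, 35, 47]), ([0, 3, 43, 38, 42, 44, 46, 41,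
     45, 5, 1, 79, 4, 76, 17, 73, 18, 74, 34, 60, 25, 59, 30, 54, 37, 53, 28, 56, 39, 49, 32,
     58, 33, 47, 81, 62, 31, 51, 40, 50, 10], [2, 7, 8, 48, 35, 55, 26, 64, 27, 67, 22, 70,
     15, 69, 16, 72, 11, 71, 14, 78, 13, 77, 6, 9, 75, 20, 66, 29, 57, 36, 52, 12, 68, 19, 61,
     21, 63, 23, 65, 24, 80]), ([0, 9, 77, 12, 74, 7, 1, 2, 13, 71, 10, 4, 44, 39, 47, 36, 58,
     27, 59, 22, 68, 17, 65, 18, 66, 15, 79, 14, 72, 32, 52, 33, 51, 11, 69, 24, 70, 21, 80,
     3, 8], [5, 75, 6, 76, 19, 73, 16, 64, 31, 63, 20, 62, 25, 55, 30, 56, 29, 61, 34, 50, 41,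
     43, 49, 42, 81, 67, 28, 60, 23, 57, 26, 54, 35, 53, 40, 46, 48, 37, 45, 38, 78]), ([0,
     40, 48, 47, 42, 39, 41, 51, 44, 37, 77, 18, 64, 24, 66, 19, 59, 36, 56, 35, 57, 17, 69,
     22, 72, 13, 79, 8, 76, 11, 1, 4, 7, 75, 14, 70, 30, 50, 31, 71, 12], [2, 78, 9, 49, 34,
     58, 23, 67, 26, 62, 21, 61, 20, 60, 27, 65, 16, 68, 25, 80, 5, 45, 81, 63, 28, 52, 29,
     53, 38, 46, 43, 3, 6, 74, 15, 55, 32, 54, 33, 73, 10]), ([0, 13, 69, 29, 51, 32, 62, 27,
     53, 36, 76, 15, 71, 22, 80, 81, 60, 20, 74, 11, 75, 16, 78, 7, 5, 79, 6, 4, 9, 73, 8, 2,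
     3, 1, 12, 70, 25, 57, 38, 54, 14], [10, 50, 35, 49, 40, 52, 41, 47, 44, 48, 39, 43, 45,
     42, 46, 37, 55, 34, 56, 33, 61, 30, 58, 31, 59, 26, 68, 21, 67, 18, 72, 19, 65, 28, 66,
     23, 63, 24, 64, 17, 77]), ([0, 1, 8, 72, 17, 75, 35, 59, 24, 68, 15, 77, 16, 74, 13, 67,
     14, 66, 21, 69, 18, 70, 23, 80, 7, 73, 12, 78, 3, 10, 76, 36, 54, 41, 81, 61, 26, 58, 29,
     55, 40], [2, 9, 5, 6, 46, 45, 44, 4, 11, 79, 39, 53, 30, 52, 43, 47, 34, 48, 33, 57, 28,
     62, 19, 71, 20, 64, 25, 65, 22, 60, 31, 49, 38, 56, 27, 63, 32, 50, 37, 51, 42])]"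
  by code_simp

lemma rearrangement_43:
  "rearrangement 43
    [([0, 15, 77, 35, 63, 24, 66, 33, 57, 42, 44, 48, 6, 7, 81, 10, 74, 13, 75, 22, 84, 4, 82,
     11, 83, 2, 3, 45, 47, 5, 8, 78, 9, 1, 12, 76, 17, 59, 36, 54, 37, 79, 14], [16, 80, 19,
     71, 29, 65, 20, 64, 21, 69, 30, 72, 23, 67, 25, 73, 26, 62, 27, 61, 34, 50, 41, 51, 40,
     56, 43, 49, 46, 85, 68, 31, 53, 38, 52, 39, 55, 32, 60, 18, 70, 28, 58]), ([0, 13, 81,
     16, 82, 17, 77, 18, 66, 27, 63, 28, 70, 25, 69, 22, 72, 21, 65, 30, 56, 29, 71, 26, 68,
     23, 61, 36, 60, 35, 55, 34, 62, 20, 74, 19, 73, 12, 78, 11, 75, 24, 84], [1, 14, 76, 15,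
     83, 41, 45, 44, 2, 9, 79, 8, 6, 4, 5, 3, 10, 80, 7, 49, 48, 37, 53, 46, 50, 47, 85, 67,
     32, 64, 33, 59, 40, 58, 31, 57, 38, 54, 39, 51, 42, 52, 43]), ([0, 42, 46, 48, 43, 85,
     66, 23, 84, 5, 1, 10, 2, 7, 8, 76, 19, 75, 33, 65, 28, 56, 37, 55, 13, 79, 18, 80, 15,
     69, 26, 72, 27, 67, 20, 68, 21, 71, 16, 74, 32, 54, 12], [3, 83, 6, 78, 17, 73, 24, 70,
     29, 59, 30, 64, 31, 63, 22, 62, 25, 61, 38, 58, 35, 77, 14, 82, 9, 51, 44, 41, 57, 34,
     60, 39, 81, 4, 11, 53, 40, 52, 47, 49, 36, 50, 45]), ([0, 3, 4, 9, 77, 12, 54, 45, 85,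
     63, 21, 84, 1, 6, 48, 41, 83, 8, 2, 82, 7, 5, 10, 52, 35, 61, 24, 64, 27, 69, 18, 72, 15,
     57, 40, 46, 43, 51, 36, 62, 37, 47, 42], [11, 81, 39, 59, 28, 60, 33, 53, 32, 74, 23, 71,
     22, 66, 25, 65, 26, 70, 19, 79, 16, 76, 34, 58, 29, 67, 30, 68, 17, 75, 20, 78, 13, 73,
     31, 55, 44, 50, 49, 38, 56, 14, 80]), ([0, 9, 75, 14, 78, 19, 69, 20, 76, 11, 77, 16, 70,
     21, 63, 26, 60, 27, 84, 3, 81, 12, 72, 25, 67, 22, 64, 35, 49, 40, 44, 54, 41, 43, 53,
     34, 52, 37, 59, 38, 48, 50, 8], [1, 2, 5, 47, 51, 46, 4, 7, 83, 10, 82, 15, 71, 28, 66,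
     24, 68, 29, 57, 30, 62, 33, 55, 36, 56, 31, 61, 32, 58, 39, 45, 42, 85, 65, 23, 73, 18,
     74, 17, 79, 6, 80, 13]), ([0, 1, 43, 42, 48, 85, 64, 22, 74, 15, 81, 14, 72, 13, 77, 8,
     80, 17, 69, 27, 71, 18, 60, 31, 65, 24, 62, 29, 55, 38, 50, 39, 57, 36, 78, 21, 67, 28,
     84, 7, 3, 6, 2], [4, 46, 45, 53, 11, 73, 20, 70, 23, 63, 32, 56, 35, 51, 34, 76, 9, 83,
     16, 68, 25, 59, 26, 66, 19, 61, 30, 58, 41, 47, 40, 54, 33, 75, 12, 82, 5, 79, 37, 49,
     44, 52, 10]), ([0, 5, 6, 9, 81, 18, 78, 36, 52, 33, 63, 30, 60, 29, 61, 28, 64, 25, 71,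
     24, 74, 11, 1, 8, 82, 3, 12, 80, 38, 46, 39, 53, 42, 54, 43, 47, 44, 85, 84, 2, 13, 83,
     4], [7, 79, 20, 62, 31, 73, 14, 70, 27, 59, 32, 66, 21, 77, 22, 68, 19, 65, 34, 56, 41,
     55, 40, 50, 35, 57, 15, 75, 10, 76, 23, 69, 16, 72, 17, 67, 26, 58, 37, 51, 48, 45, 49]),
     ([0, 7, 77, 20, 66, 29, 69, 24, 72, 30, 54, 31, 59, 34, 64, 23, 65, 32, 52, 45, 40, 82,
     13, 71, 14, 74, 25, 63, 36, 48, 39, 47, 38, 60, 37, 61, 19, 67, 18, 68, 26, 84, 6], [1,
     4, 80, 5, 83, 12, 2, 11, 79, 10, 78, 15, 73, 22, 76, 21, 75, 16, 58, 27, 57, 28, 62, 35,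
     53, 44, 46, 41, 49, 85, 70, 17, 81, 8, 50, 43, 55, 42, 56, 33, 51, 9, 3]), ([0, 11, 3, 8,
     4, 2, 44, 43, 45, 51, 38, 80, 9, 5, 81, 6, 82, 40, 48, 47, 46, 52, 41, 53, 36, 58, 33,
     61, 26, 64, 29, 63, 34, 54, 35, 59, 17, 71, 20, 72, 19, 77, 10], [1, 83, 14, 56, 39, 49,
     42, 50, 37, 57, 32, 62, 23, 75, 18, 76, 13, 55, 30, 66, 31, 67, 24, 60, 25, 84, 85, 69,
     28, 68, 27, 65, 22, 70, 15, 79, 12, 74, 21, 73, 16, 78, 7])]"
  by code_simp

lemma rearrangement_45:
  "rearrangement 45
    [([0, 17, 87, 14, 80, 23, 71, 20, 82, 15, 59, 44, 56, 33, 65, 26, 74, 27, 79, 16, 78, 13,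
     57, 38, 58, 45, 61, 28, 76, 31, 69, 34, 68, 24, 70, 19, 83, 18, 84, 5, 12, 4, 7, 1, 2],
     [3, 10, 6, 86, 21, 73, 22, 66, 39, 49, 53, 48, 89, 75, 32, 72, 25, 88, 9, 85, 41, 51, 46,
     50, 54, 37, 81, 8, 11, 77, 30, 64, 29, 67, 40, 60, 43, 63, 36, 62, 35, 55, 42, 52, 47]),
     ([0, 9, 7, 51, 44, 48, 50, 49, 42, 62, 18, 76, 19, 73, 29, 65, 40, 54, 53, 46, 58, 31,
     67, 26, 70, 33, 71, 36, 60, 37, 57, 34, 64, 43, 47, 59, 30, 88, 5, 85, 14, 4, 86, 3, 6],
     [1, 8, 84, 21, 75, 24, 66, 27, 61, 32, 56, 45, 89, 72, 35, 79, 22, 78, 25, 81, 16, 80,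
     13, 87, 10, 2, 15, 77, 12, 82, 38, 52, 41, 55, 11, 83, 39, 63, 28, 68, 23, 69, 20, 74,
     17]), ([0, 44, 52, 39, 67, 36, 80, 19, 79, 28, 74, 33, 61, 30, 60, 47, 55, 46, 2, 11, 85,
     20, 70, 29, 75, 14, 78, 21, 65, 32, 76, 17, 77, 18, 72, 23, 88, 3, 12, 56, 35, 53, 42,
     48, 4], [1, 10, 54, 49, 40, 64, 27, 73, 16, 86, 13, 5, 83, 24, 82, 7, 87, 8, 6, 9, 81,
     37, 69, 26, 62, 41, 63, 34, 58, 43, 57, 50, 45, 51, 89, 66, 31, 59, 38, 68, 25, 71, 22,
     84, 15]), ([0, 3, 1, 87, 20, 78, 23, 79, 18, 86, 9, 83, 22, 68, 29, 71, 27, 65, 34, 72,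
     21, 77, 14, 82, 25, 69, 28, 64, 37, 55, 48, 43, 51, 40, 66, 41, 53, 52, 49, 44, 89, 88,
     2, 5, 8], [4, 13, 75, 16, 60, 39, 61, 42, 50, 56, 47, 46, 45, 59, 32, 62, 31, 63, 30, 70,
     35, 57, 36, 58, 33, 67, 38, 54, 10, 84, 11, 7, 12, 80, 17, 81, 26, 76, 15, 73, 24, 74,
     19, 85, 6]), ([0, 5, 6, 82, 17, 71, 32, 66, 25, 77, 33, 69, 38, 64, 20, 80, 15, 85, 4, 2,
     13, 1, 45, 55, 40, 84, 19, 75, 22, 74, 31, 65, 21, 81, 10, 8, 9, 79, 24, 78, 29, 61, 34,
     60, 16], [3, 14, 86, 11, 87, 18, 62, 39, 83, 12, 76, 27, 63, 44, 54, 43, 53, 36, 70, 23,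
     67, 30, 68, 35, 59, 42, 58, 47, 49, 48, 56, 41, 57, 46, 52, 37, 51, 50, 89, 73, 26, 72,
     28, 88, 7]), ([0, 1, 6, 50, 43, 49, 55, 34, 66, 35, 61, 17, 73, 30, 72, 31, 75, 26, 68,
     21, 67, 24, 88, 89, 70, 27, 71, 28, 62, 33, 57, 13, 85, 16, 2, 3, 4, 11, 5, 87, 12, 86,
     7, 81, 18], [8, 80, 25, 79, 20, 84, 9, 10, 78, 19, 69, 36, 56, 37, 63, 38, 82, 23, 77,
     22, 76, 32, 64, 39, 53, 40, 52, 54, 51, 48, 41, 65, 42, 46, 60, 45, 47, 44, 58, 14, 74,
     29, 59, 15, 83]), ([0, 11, 81, 22, 70, 26, 64, 25, 65, 30, 74, 21, 83, 14, 2, 46, 89, 68,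
     37, 59, 36, 66, 29, 69, 32, 58, 41, 49, 57, 48, 45, 44, 62, 43, 61, 40, 56, 39, 55, 38,
     60, 31, 88, 1, 12], [3, 85, 10, 4, 84, 17, 75, 28, 78, 27, 67, 34, 54, 47, 53, 50, 6, 7,
     8, 52, 51, 42, 86, 15, 87, 16, 82, 13, 79, 35, 63, 19, 71, 24, 72, 33, 77, 20, 76, 23,
     73, 18, 80, 9, 5]), ([0, 15, 79, 12, 78, 34, 56, 51, 55, 50, 47, 42, 64, 41, 59, 40, 62,
     37, 53, 89, 67, 28, 60, 29, 63, 32, 70, 25, 75, 31, 71, 18, 82, 9, 3, 16, 74, 23, 81, 24,
     76, 13, 77, 26, 88], [1, 4, 48, 54, 35, 65, 36, 52, 8, 2, 86, 17, 61, 38, 66, 33, 73, 20,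
     68, 27, 69, 30, 58, 39, 57, 44, 46, 43, 45, 49, 5, 14, 84, 7, 83, 10, 80, 21, 85, 22, 72,
     19, 87, 6, 11]), ([0, 19, 77, 28, 66, 22, 88, 6, 2, 9, 53, 44, 60, 35, 69, 24, 68, 31,
     61, 36, 64, 33, 63, 42, 56, 43, 87, 4, 15, 81, 20, 72, 29, 73, 32, 74, 25, 67, 23, 83,
     16, 76, 21, 79, 14], [1, 18, 70, 37, 65, 38, 50, 41, 47, 51, 7, 10, 82, 11, 55, 52, 89,
     71, 26, 80, 27, 75, 30, 62, 45, 57, 40, 48, 58, 49, 46, 54, 39, 59, 34, 78, 17, 85, 12,
     84, 13, 3, 8, 86, 5]), ([0, 7, 5, 49, 51, 53, 38, 62, 29, 77, 24, 64, 35, 67, 32, 68, 33,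
     59, 48, 52, 43, 55, 44, 50, 39, 65, 28, 72, 27, 88, 4, 9, 87, 2, 17, 83, 20, 86, 19, 63,
     26, 78, 11, 79, 10], [1, 16, 84, 40, 58, 37, 61, 46, 56, 12, 6, 13, 81, 14, 76, 25, 73,
     34, 70, 31, 57, 42, 60, 41, 85, 8, 82, 21, 71, 30, 66, 23, 75, 18, 74, 15, 3, 47, 89, 69,
     22, 80, 36, 54, 45]), ([0, 13, 83, 6, 84, 23, 65, 24, 80, 11, 3, 87, 43, 59, 46, 48, 47,
     57, 32, 60, 33, 55, 36, 68, 39, 51, 38, 56, 49, 89, 74, 30, 76, 29, 88, 8, 4, 5, 10, 86,
     42, 54, 41, 61, 44], [1, 14, 58, 35, 71, 34, 62, 27, 77, 16, 72, 17, 79, 26, 66, 37, 67,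
     22, 82, 19, 81, 12, 2, 7, 85, 18, 78, 15, 75, 20, 64, 31, 73, 28, 70, 21, 69, 25, 63, 40,
     50, 52, 45, 53, 9])]"
  by code_simp

text \<open>The longest certificate: thirteen classes, made from the leftover arcs and twelve of the
  92 translates.\<close>

lemma rearrangement_47:
  "rearrangement 47
    [([0, 5, 3, 18, 74, 25, 87, 28, 92, 9, 1, 14, 90, 11, 12, 8, 2, 7, 53, 93, 72, 26, 86, 15,
     79, 22, 80, 27, 73, 36, 62, 31, 75, 32, 82, 33, 71, 44, 70, 45, 67, 21, 91, 6, 13, 89,
     10], [4, 88, 17, 81, 30, 78, 19, 83, 24, 68, 41, 61, 38, 66, 20, 84, 29, 85, 39, 65, 42,
     64, 37, 59, 48, 47, 46, 58, 49, 55, 52, 54, 56, 51, 57, 50, 43, 63, 40, 60, 35, 69, 34,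
     76, 23, 77, 16]), ([0, 21, 83, 28, 72, 25, 67, 36, 64, 51, 5, 16, 2, 90, 13, 1, 4, 19,
     75, 30, 92, 10, 11, 57, 56, 93, 78, 35, 77, 34, 74, 39, 55, 59, 46, 66, 31, 79, 26, 68,
     43, 89, 18, 76, 17, 85, 20], [3, 49, 53, 44, 48, 58, 47, 61, 42, 54, 41, 69, 24, 80, 23,
     73, 40, 52, 6, 86, 29, 63, 50, 60, 45, 91, 22, 82, 27, 71, 38, 62, 37, 65, 32, 70, 33,
     81, 12, 88, 7, 14, 84, 15, 87, 8, 9]), ([0, 46, 68, 31, 69, 42, 50, 47, 55, 9, 14, 6, 2,
     5, 12, 80, 25, 89, 26, 72, 21, 73, 38, 84, 19, 87, 18, 78, 33, 77, 30, 62, 41, 71, 36,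
     82, 17, 1, 20, 88, 13, 81, 24, 74, 23, 92, 4], [3, 91, 16, 86, 11, 83, 22, 76, 39, 63,
     32, 64, 29, 65, 40, 56, 45, 53, 59, 52, 51, 44, 60, 43, 67, 48, 93, 70, 27, 79, 34, 58,
     35, 75, 28, 66, 37, 57, 54, 49, 61, 15, 7, 85, 10, 8, 90]), ([0, 3, 16, 80, 33, 59, 42,
     56, 58, 43, 53, 55, 48, 45, 49, 65, 46, 50, 93, 71, 40, 66, 27, 92, 11, 91, 4, 15, 1, 2,
     13, 5, 10, 82, 36, 60, 51, 61, 44, 54, 8, 6, 88, 9, 7, 87, 22], [12, 84, 25, 73, 34, 62,
     35, 81, 14, 78, 29, 77, 28, 76, 30, 68, 39, 69, 32, 72, 31, 83, 37, 67, 26, 74, 19, 79,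
     24, 90, 17, 89, 20, 86, 21, 75, 18, 64, 41, 57, 52, 47, 63, 38, 70, 23, 85]), ([0, 9, 91,
     18, 4, 50, 58, 41, 63, 17, 3, 89, 8, 86, 23, 83, 12, 10, 56, 37, 69, 40, 62, 53, 48, 54,
     43, 51, 55, 57, 36, 78, 25, 77, 26, 84, 38, 76, 31, 92, 7, 5, 6, 11, 87, 14, 2], [1, 16,
     90, 44, 64, 47, 65, 19, 81, 28, 74, 29, 71, 32, 60, 49, 46, 52, 93, 80, 15, 85, 22, 70,
     24, 88, 27, 67, 42, 68, 45, 59, 13, 79, 33, 75, 20, 72, 35, 61, 34, 66, 39, 73, 30, 82,
     21]), ([0, 17, 63, 48, 64, 39, 59, 44, 56, 47, 1, 22, 68, 37, 61, 50, 54, 45, 57, 40, 58,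
     53, 7, 10, 84, 9, 5, 14, 8, 15, 83, 32, 92, 93, 79, 20, 2, 3, 4, 90, 23, 81, 18, 86, 13,
     91, 12], [6, 52, 62, 49, 51, 46, 60, 33, 69, 36, 74, 35, 71, 24, 82, 11, 89, 16, 76, 27,
     85, 30, 80, 19, 77, 31, 65, 34, 70, 25, 75, 29, 73, 26, 88, 42, 66, 43, 55, 38, 72, 41,
     67, 28, 78, 21, 87]), ([0, 11, 9, 89, 43, 71, 42, 88, 23, 75, 24, 76, 37, 73, 22, 78, 27,
     69, 26, 82, 29, 81, 20, 66, 41, 55, 40, 68, 25, 83, 30, 74, 21, 79, 36, 70, 35, 59, 54,
     53, 46, 93, 92, 6, 7, 1, 18], [2, 15, 3, 8, 4, 13, 87, 12, 86, 19, 91, 14, 60, 39, 85,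
     28, 80, 17, 77, 32, 62, 16, 84, 31, 61, 52, 58, 45, 47, 67, 38, 64, 49, 57, 44, 50, 56,
     10, 90, 5, 51, 63, 34, 72, 33, 65, 48]), ([0, 15, 81, 34, 64, 43, 65, 38, 68, 22, 72, 29,
     69, 23, 91, 24, 92, 5, 18, 88, 21, 71, 30, 84, 27, 87, 10, 4, 2, 9, 85, 26, 80, 35, 67,
     44, 66, 45, 51, 93, 76, 25, 79, 14, 86, 7, 8], [1, 6, 17, 75, 40, 70, 41, 53, 42, 52, 60,
     37, 83, 16, 78, 32, 74, 31, 77, 20, 90, 19, 89, 12, 58, 55, 46, 48, 62, 33, 73, 28, 82,
     13, 59, 50, 49, 63, 36, 56, 39, 61, 54, 47, 57, 11, 3]), ([0, 13, 7, 91, 10, 2, 11, 1, 8,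
     88, 15, 5, 87, 26, 92, 3, 20, 80, 31, 81, 32, 66, 29, 67, 30, 76, 19, 85, 14, 4, 17, 83,
     18, 82, 23, 79, 16, 62, 51, 53, 52, 49, 44, 90, 9, 12, 6], [21, 89, 24, 72, 39, 71, 34,
     78, 37, 55, 50, 64, 45, 65, 36, 68, 35, 73, 27, 75, 38, 54, 58, 57, 48, 60, 47, 93, 77,
     22, 74, 33, 63, 42, 70, 43, 61, 46, 56, 41, 59, 40, 86, 25, 69, 28, 84]), ([0, 1, 47, 53,
     61, 36, 72, 43, 59, 38, 60, 41, 65, 44, 62, 39, 75, 22, 86, 40, 74, 28, 68, 27, 83, 20,
     82, 15, 77, 18, 84, 23, 71, 26, 66, 33, 92, 8, 54, 51, 48, 50, 4, 11, 7, 89, 14], [2, 19,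
     73, 32, 76, 29, 79, 30, 70, 37, 63, 52, 56, 49, 3, 10, 88, 25, 81, 35, 57, 93, 69, 46,
     64, 31, 67, 34, 80, 13, 9, 87, 16, 6, 90, 21, 85, 24, 78, 17, 5, 91, 45, 55, 42, 58,
     12]), ([0, 7, 16, 88, 19, 65, 28, 86, 27, 77, 36, 58, 51, 42, 72, 37, 71, 25, 85, 8, 11,
     5, 89, 6, 4, 9, 55, 44, 52, 45, 61, 32, 68, 29, 83, 10, 13, 3, 14, 82, 31, 73, 24, 70,
     39, 57, 46], [1, 12, 90, 15, 91, 2, 48, 66, 35, 63, 30, 64, 33, 67, 40, 54, 60, 53, 50,
     62, 47, 59, 56, 43, 49, 93, 75, 26, 78, 23, 69, 38, 74, 41, 87, 20, 76, 21, 81, 22, 84,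
     17, 79, 18, 80, 34, 92]), ([0, 23, 87, 24, 84, 11, 81, 26, 70, 31, 63, 46, 62, 43, 57,
     42, 60, 55, 54, 93, 73, 20, 74, 37, 75, 36, 76, 35, 79, 28, 64, 18, 90, 25, 71, 22, 88,
     5, 1, 10, 86, 17, 91, 8, 13, 85, 16], [2, 21, 77, 38, 56, 53, 40, 72, 27, 65, 30, 66, 47,
     49, 59, 34, 68, 33, 61, 48, 52, 41, 51, 50, 45, 69, 44, 58, 39, 67, 32, 78, 15, 89, 4, 7,
     12, 82, 19, 3, 6, 9, 83, 14, 80, 29, 92]), ([0, 19, 1, 91, 20, 78, 31, 71, 28, 70, 29,
     75, 34, 60, 14, 88, 11, 85, 18, 2, 17, 87, 41, 73, 42, 62, 45, 63, 44, 68, 47, 51, 59,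
     36, 66, 49, 48, 56, 55, 93, 74, 27, 81, 16, 82, 25, 92], [3, 12, 4, 5, 8, 84, 13, 83, 26,
     76, 33, 79, 32, 80, 21, 67, 46, 54, 39, 53, 57, 38, 58, 37, 77, 24, 86, 9, 10, 6, 15, 61,
     40, 64, 35, 65, 50, 52, 43, 69, 30, 72, 23, 89, 22, 90, 7])]"
  by code_simp

lemma rearrangement_49:
  "rearrangement 49
    [([0, 9, 3, 93, 4, 5, 95, 10, 90, 19, 67, 48, 60, 12, 94, 46, 52, 97, 79, 22, 86, 23, 87,
     39, 71, 42, 64, 43, 65, 32, 80, 17, 85, 37, 75, 26, 72, 24, 78, 27, 83, 16, 84, 21, 69,
     30, 82, 29, 96], [1, 14, 88, 11, 91, 18, 92, 13, 61, 38, 62, 45, 55, 54, 49, 57, 40, 70,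
     31, 77, 34, 66, 35, 73, 36, 76, 33, 63, 15, 81, 28, 74, 25, 89, 20, 68, 41, 59, 44, 58,
     47, 51, 53, 50, 56, 8, 6, 2, 7]), ([0, 17, 79, 31, 73, 28, 78, 19, 77, 26, 80, 23, 71,
     30, 84, 36, 68, 47, 95, 14, 86, 25, 81, 33, 67, 44, 66, 43, 59, 38, 58, 51, 57, 50, 64,
     35, 83, 24, 72, 27, 87, 10, 94, 13, 1, 16, 2, 3, 8], [4, 92, 21, 85, 18, 88, 9, 5, 6, 11,
     89, 12, 90, 7, 93, 20, 76, 37, 63, 46, 60, 53, 48, 97, 74, 39, 61, 42, 56, 41, 69, 40,
     62, 49, 55, 52, 54, 45, 65, 34, 82, 15, 91, 22, 70, 29, 75, 32, 96]), ([0, 19, 83, 20,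
     84, 15, 87, 24, 82, 27, 69, 42, 90, 23, 73, 30, 68, 35, 75, 34, 62, 39, 67, 40, 64, 47,
     53, 61, 36, 78, 33, 79, 18, 86, 21, 89, 26, 74, 31, 81, 16, 80, 25, 77, 38, 70, 45, 93,
     14], [1, 10, 6, 54, 58, 41, 63, 52, 51, 46, 94, 11, 59, 56, 49, 65, 44, 60, 55, 50, 97,
     72, 29, 85, 22, 92, 9, 7, 95, 4, 13, 3, 12, 2, 5, 91, 43, 57, 48, 66, 37, 71, 32, 76, 28,
     96, 8, 88, 17]), ([0, 11, 85, 12, 86, 27, 73, 24, 76, 31, 79, 32, 82, 25, 87, 22, 88, 19,
     89, 18, 84, 23, 91, 6, 7, 55, 97, 75, 28, 80, 35, 77, 30, 78, 21, 83, 26, 96, 9, 10, 8,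
     90, 13, 95, 20, 94, 5, 93, 16], [1, 2, 50, 54, 60, 47, 67, 36, 74, 33, 65, 48, 64, 39,
     57, 56, 45, 51, 59, 46, 68, 29, 71, 40, 58, 49, 63, 42, 62, 14, 92, 17, 81, 34, 72, 37,
     69, 38, 66, 41, 61, 44, 70, 43, 53, 52, 4, 15, 3]), ([0, 7, 3, 51, 61, 50, 52, 60, 45,
     69, 32, 78, 30, 80, 27, 75, 36, 84, 29, 77, 24, 88, 13, 83, 18, 66, 31, 65, 42, 54, 47,
     63, 40, 68, 43, 67, 38, 74, 35, 79, 20, 86, 19, 91, 14, 2, 17, 89, 10], [1, 6, 9, 95, 16,
     90, 25, 85, 28, 72, 41, 71, 23, 81, 22, 82, 21, 93, 8, 11, 87, 26, 70, 33, 96, 97, 76,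
     39, 59, 48, 62, 37, 73, 34, 64, 49, 53, 46, 56, 58, 55, 57, 44, 92, 5, 12, 4, 94, 15]),
     ([0, 15, 85, 14, 90, 21, 91, 12, 88, 27, 77, 36, 72, 31, 67, 19, 93, 45, 59, 40, 60, 41,
     57, 97, 81, 32, 74, 37, 61, 48, 54, 56, 43, 55, 42, 68, 20, 80, 33, 71, 44, 62, 51, 63,
     50, 2, 9, 87, 18], [1, 95, 6, 13, 89, 24, 96, 7, 10, 86, 11, 3, 4, 52, 58, 53, 5, 8, 92,
     23, 75, 22, 78, 29, 83, 30, 76, 35, 69, 28, 84, 25, 79, 26, 82, 34, 70, 39, 73, 38, 64,
     16, 94, 17, 65, 46, 66, 47, 49]), ([0, 1, 8, 94, 9, 91, 24, 74, 26, 88, 23, 89, 22, 90,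
     15, 95, 18, 80, 29, 73, 25, 96, 3, 6, 4, 7, 12, 60, 49, 59, 50, 58, 43, 71, 34, 68, 31,
     75, 40, 56, 55, 44, 52, 45, 63, 36, 64, 51, 48], [2, 13, 5, 53, 57, 46, 62, 47, 61, 54,
     97, 78, 37, 77, 32, 70, 41, 65, 17, 83, 14, 84, 19, 81, 30, 72, 35, 67, 42, 66, 39, 87,
     16, 82, 33, 69, 21, 79, 28, 86, 38, 76, 27, 85, 20, 92, 11, 93, 10]), ([0, 13, 91, 8, 2,
     94, 3, 16, 88, 21, 77, 28, 70, 27, 71, 38, 68, 33, 81, 20, 78, 35, 63, 44, 54, 43, 61,
     46, 64, 41, 89, 14, 82, 23, 85, 26, 86, 15, 83, 32, 72, 39, 75, 24, 84, 17, 87, 12, 6],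
     [1, 4, 9, 93, 22, 80, 31, 69, 34, 76, 25, 73, 40, 66, 18, 90, 42, 60, 37, 67, 30, 74, 29,
     79, 36, 62, 53, 59, 11, 7, 5, 10, 92, 19, 95, 47, 65, 50, 49, 51, 55, 48, 58, 45, 57, 52,
     56, 97, 96]), ([0, 5, 14, 62, 41, 73, 32, 66, 45, 67, 46, 54, 51, 3, 10, 58, 57, 42, 72,
     33, 77, 29, 69, 36, 60, 43, 91, 20, 82, 31, 96, 6, 92, 44, 56, 53, 97, 80, 19, 79, 34,
     78, 25, 75, 38, 86, 17, 95, 2], [1, 12, 84, 27, 81, 24, 90, 9, 89, 16, 64, 37, 85, 30,
     70, 22, 74, 23, 83, 35, 71, 26, 76, 21, 87, 28, 68, 39, 65, 40, 88, 15, 63, 48, 50, 47,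
     55, 59, 52, 49, 61, 13, 93, 18, 94, 7, 8, 4, 11]), ([0, 48, 52, 47, 57, 9, 1, 18, 78, 31,
     83, 22, 76, 23, 77, 20, 88, 25, 71, 28, 82, 19, 87, 14, 94, 21, 81, 26, 84, 13, 85, 24,
     80, 32, 68, 45, 61, 40, 72, 43, 63, 38, 60, 39, 69, 46, 58, 10, 4], [2, 11, 5, 3, 95, 12,
     92, 15, 93, 6, 90, 17, 91, 16, 86, 29, 67, 34, 74, 41, 55, 7, 89, 8, 56, 51, 50, 62, 35,
     65, 36, 66, 49, 97, 73, 42, 70, 37, 59, 54, 53, 44, 64, 33, 75, 27, 79, 30, 96]), ([0, 3,
     14, 4, 2, 15, 89, 41, 67, 32, 64, 45, 53, 55, 46, 50, 60, 51, 97, 77, 22, 84, 31, 71, 36,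
     70, 35, 61, 52, 62, 43, 69, 44, 68, 37, 65, 38, 72, 25, 83, 28, 76, 29, 81, 18, 82, 17,
     93, 12], [1, 49, 48, 56, 47, 59, 42, 58, 39, 63, 34, 80, 21, 75, 30, 66, 33, 73, 26, 78,
     23, 79, 24, 86, 13, 87, 20, 90, 11, 95, 8, 9, 57, 54, 6, 94, 19, 85, 16, 92, 7, 91, 10,
     88, 40, 74, 27, 96, 5])]"
  by code_simp

section \<open>All cycle lengths together\<close>

lemmas rearrangements =
  rearrangement_5 rearrangement_7 rearrangement_9 rearrangement_11 rearrangement_13
  rearrangement_15 rearrangement_17 rearrangement_19 rearrangement_21 rearrangement_23
  rearrangement_25 rearrangement_27 rearrangement_29 rearrangement_31 rearrangement_33
  rearrangement_35 rearrangement_37 rearrangement_39 rearrangement_41 rearrangement_43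
  rearrangement_45 rearrangement_47 rearrangement_49

theorem theorem1p4:
  fixes m :: nat and G :: "('a, 'b) pre_digraph"
  assumes "odd m" and "5 \<le> m" and "m \<le> 49"
    and "complete_digraph (2 * m) G"
  shows "\<exists>\<D>. decomposition G \<D> \<and> resolvable G \<D> \<and> (\<forall>C \<in> \<D>. directed_cycle m C)"
proof -
  \<comment> \<open>Writing the range as an explicit list turns the hypotheses on \<open>m\<close>
    into a choice among numerals, and each numeral selects its certificate.\<close>
  have "m \<in> set (filter odd [5..<50])"
    by (simp only: set_filter set_upt mem_Collect_eq atLeastLessThan_iff) (use assms in auto)
  also have "filter odd [5..<50] =
    [5, 7, 9, 11, 13, 15, 17, 19, 21, 23, 25, 27, 29, 31, 33, 35, 37, 39, 41, 43, 45, 47, 49]"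
    by code_simp
  finally have "\<exists>Es. rearrangement m Es"
    unfolding list.set
    by - (elim insertE emptyE; hypsubst; rule exI; rule rearrangements)
  then show ?thesis
    using resolvable_decomposition_of_rearrangement[OF assms(1) _ assms(4)] assms(2) by auto
qed

end
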